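(* Let $p\in\mathbb{R}$, $q\ge0$. Define $\tilde J$ on $T(T^\perp L)$ by $$(\tilde J\xi^v)_\theta=\omega_\theta^{p/2}\left((J\xi)^h_\theta+\frac{q}{1+\sqrt{1+q\langle\theta,\theta\rangle^\perp}}\langle\xi,\theta\rangle^\perp\,J^h_\theta\right),$$ $$(\tilde JX^h)_\theta=\frac{1}{\omega_\theta^{p/2}}\left((JX)^v_\theta-\frac{q}{1+q\langle\theta,\theta\rangle^\perp+\sqrt{1+q\langle\theta,\theta\rangle^\perp}}\langle JX,\theta\rangle^\perp\,\Theta_\theta\right).$$ Then $(T^\perp L,h_{p,q},\tilde J)$ is an almost Hermitian manifold, i.e. $\tilde J^2=-\mathrm{Id}$ and $h_{p,q}(\tilde JA,\tilde JB)=h_{p,q}(A,B)$.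
   Context: All objects are smooth. $(M,g)$ is a Riemannian manifold of dimension $2k$ with an almost complex structure $J$ compatible with $g$ (i.e. $g(JU,JV)=g(U,V)$), and $L\subset M$ is a $k$-dimensional totally real submanifold in the sense that for every $x\in L$, $T_xM$ is the orthogonal direct sum of $T_xL$ and $J(T_xL)$ (so $J$ interchanges $T_xL$ and $T_x^\perp L$). $\langle\cdot,\cdot\rangle$ is the metric induced by $g$ on $L$; $\pi:T^\perp L\to L$ is the normal bundle with fibre metric $\langle\cdot,\cdot\rangle^\perp$ induced by $g$, and normal connection $\nabla^\perp$. The connection map $K:T(T^\perp L)\to T^\perp L$ is the unique bundle morphism such that $K:T_\theta(T^\perp_xL)\to T^\perp_xL$ is the canonical isomorphism for $\theta\in T_x^\perp L$, and $K(\xi_*X)=\nabla^\perp_X\xi$ for every section $\xi$ of $T^\perp L$ and vector field $X$ on $L$. $X^h$ is the horizontal lift of $X$ ($KX^h=0$, $\pi_*X^h=X$), $\xi^v$ the vertical lift of $\xi$ ($\pi_*\xi^v=0$, $K\xi^v=\xi$), $\Theta$ the vertical vector field with $K(\Theta_\theta)=\theta$, and $J^h$ the horizontal vector field $J^h_\theta=(J\theta)^h_\theta$. With $\omega_\theta=\frac{1}{1+\langle\theta,\theta\rangle^\perp}$, the $(p,q)$-metric on $T^\perp L$ is $$h_{p,q}(A,B)=\langle\pi_*A,\pi_*B\rangle+\omega_\theta^p\big(\langle KA,KB\rangle^\perp+q\langle KA,\theta\rangle^\perp\langle KB,\theta\rangle^\perp\big),\quad A,B\in T_\theta(T^\perp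 L).$$ *)

theory Defs
  imports "HOL-Analysis.Analysis" "HOL-Library.Function_Algebras"
begin

section \<open>Linear algebra on subspaces of function spaces\<close>

text \<open>Tangent vectors are going to be functions (families of coordinate vectors indexed by charts),
  so real-valued scaling of functions is needed on top of the pointwise addition of
  \<^theory>\<open>HOL-Library.Function_Algebras\<close>.\<close>

instantiation "fun" :: (type, real_vector) real_vector
begin

definition scaleR_fun :: "real \<Rightarrow> ('a \<Rightarrow> 'b) \<Rightarrow> 'a \<Rightarrow> 'b"
  where "scaleR_fun r f = (\<lambda>x. r *\<^sub>R f x)"

instance
  by standard (auto simp: scaleR_fun_def fun_eq_iff algebra_simps)

end

definition linear_on_space :: "'a::real_vector set \<Rightarrow> ('a \<Rightarrow> 'b::real_vector) \<Rightarrow> bool"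
  where "linear_on_space V f \<longleftrightarrow>
    (\<forall>u\<in>V. \<forall>v\<in>V. f (u + v) = f u + f v) \<and> (\<forall>r. \<forall>v\<in>V. f (r *\<^sub>R v) = r *\<^sub>R f v)"

definition inner_product_on :: "'a::real_vector set \<Rightarrow> ('a \<Rightarrow> 'a \<Rightarrow> real) \<Rightarrow> bool"
  where "inner_product_on V b \<longleftrightarrow>
    (\<forall>u\<in>V. linear_on_space V (b u)) \<and> (\<forall>u\<in>V. \<forall>v\<in>V. b u v = b v u) \<and>
    (\<forall>v\<in>V. v \<noteq> 0 \<longrightarrow> b v v > 0)"


section \<open>Smooth manifolds\<close>

text \<open>The set \<open>S\<close> is meant to be open.\<close>

primrec Ck_on :: "nat \<Rightarrow> 'a::euclidean_space set \<Rightarrow> ('a \<Rightarrow> 'b::real_normed_vector) \<Rightarrow> bool"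
  where
    "Ck_on 0 S f \<longleftrightarrow> continuous_on S f"
  | "Ck_on (Suc n) S f \<longleftrightarrow> (\<forall>x\<in>S. f differentiable (at x)) \<and>
       (\<forall>v. Ck_on n S (\<lambda>x. frechet_derivative f (at x) v))"

definition smooth_on :: "'a::euclidean_space set \<Rightarrow> ('a \<Rightarrow> 'b::real_normed_vector) \<Rightarrow> bool"
  where "smooth_on S f \<longleftrightarrow> (\<forall>n. Ck_on n S f)"

text \<open>A chart is a pair of its domain and its coordinate map (whose values outside the domain are
  irrelevant). A manifold is given by its atlas; the carrier and the topology are those determined
  by the atlas.\<close>

type_synonym ('m, 'e) chart = "'m set \<times> ('m \<Rightarrow> 'e)"

definition chart_inv :: "('m, 'e) chart \<Rightarrow> 'e \<Rightarrow> 'm"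
  where "chart_inv c = inv_into (fst c) (snd c)"

definition carrier_of :: "('m, 'e) chart set \<Rightarrow> 'm set"
  where "carrier_of A = (\<Union>c\<in>A. fst c)"

definition atlas_topology :: "('m, 'e::euclidean_space) chart set \<Rightarrow> 'm topology"
  where "atlas_topology A =
    topology (\<lambda>U. U \<subseteq> carrier_of A \<and> (\<forall>c\<in>A. open (snd c ` (U \<inter> fst c))))"

definition smooth_manifold :: "('m, 'e::euclidean_space) chart set \<Rightarrow> bool"
  where "smooth_manifold A \<longleftrightarrow>
    (\<forall>c\<in>A. inj_on (snd c) (fst c)) \<and>
    (\<forall>c\<in>A. \<forall>d\<in>A. open (snd c ` (fst c \<inter> fst d)) \<and>
       smooth_on (snd c ` (fst c \<inter> fst d)) (snd d \<circ> chart_inv c)) \<and>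
    Hausdorff_space (atlas_topology A) \<and> second_countable (atlas_topology A)"

lemma openin_atlas_topology:
  assumes "smooth_manifold A"
  shows "openin (atlas_topology A) U \<longleftrightarrow>
    U \<subseteq> carrier_of A \<and> (\<forall>c\<in>A. open (snd c ` (U \<inter> fst c)))"
proof -
  have inj: "inj_on (snd c) (fst c)" if "c \<in> A" for c
    using assms that by (auto simp: smooth_manifold_def)
  have "istopology (\<lambda>U. U \<subseteq> carrier_of A \<and> (\<forall>c\<in>A. open (snd c ` (U \<inter> fst c))))"
    unfolding istopology_def
  proof (intro conjI allI impI ballI)
    fix S T c assume S: "S \<subseteq> carrier_of A \<and> (\<forall>c\<in>A. open (snd c ` (S \<inter> fst c)))"
      and T: "T \<subseteq> carrier_of A \<and> (\<forall>c\<in>A. open (snd c ` (T \<inter> fst c)))" and c: "c \<in> A"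
    have "snd c ` ((S \<inter> T) \<inter> fst c) = snd c ` (S \<inter> fst c) \<inter> snd c ` (T \<inter> fst c)"
      using inj[OF c] by (auto simp: inj_on_def)
    then show "open (snd c ` ((S \<inter> T) \<inter> fst c))"
      using S T c by (auto intro: open_Int)
  next
    fix \<K> c assume K: "\<forall>S\<in>\<K>. S \<subseteq> carrier_of A \<and> (\<forall>c\<in>A. open (snd c ` (S \<inter> fst c)))"
      and c: "c \<in> A"
    have "snd c ` (\<Union>\<K> \<inter> fst c) = (\<Union>S\<in>\<K>. snd c ` (S \<inter> fst c))"
      by auto
    then show "open (snd c ` (\<Union>\<K> \<inter> fst c))"
      using K c by auto
  qed auto
  then show ?thesis
    by (simp add: atlas_topology_def topology_inverse')
qed

text \<open>Smoothness of a map on a set \<open>S\<close>, meant to be open in the source manifold. The openness clause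
  is continuity.\<close>

definition smooth_map_on ::
  "('m, 'e::euclidean_space) chart set \<Rightarrow> ('n, 'f::euclidean_space) chart set \<Rightarrow>
   'm set \<Rightarrow> ('m \<Rightarrow> 'n) \<Rightarrow> bool"
  where "smooth_map_on A B S f \<longleftrightarrow>
    S \<subseteq> carrier_of A \<and> f ` S \<subseteq> carrier_of B \<and>
    (\<forall>c\<in>A. \<forall>d\<in>B. let D = snd c ` {x \<in> S \<inter> fst c. f x \<in> fst d} in
       open D \<and> smooth_on D (snd d \<circ> f \<circ> chart_inv c))"

definition smooth_function :: "('m, 'e::euclidean_space) chart set \<Rightarrow> ('m \<Rightarrow> real) \<Rightarrow> bool"
  where "smooth_function A f \<longleftrightarrow> (\<forall>c\<in>A. smooth_on (snd c ` fst c) (f \<circ> chart_inv c))"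


section \<open>Tangent vectors\<close>

text \<open>A tangent vector at \<open>x\<close> assigns to every chart of the atlas around \<open>x\<close> a coordinate vector, in
  such a way that coordinate vectors transform by the derivatives of the chart transitions; it is
  \<open>0\<close> on all other charts.\<close>

type_synonym ('m, 'e) tvec = "('m, 'e) chart \<Rightarrow> 'e"

definition tangent_space :: "('m, 'e::euclidean_space) chart set \<Rightarrow> 'm \<Rightarrow> ('m, 'e) tvec set"
  where "tangent_space A x = {v.
    (\<forall>c. \<not> (c \<in> A \<and> x \<in> fst c) \<longrightarrow> v c = 0) \<and>
    (\<forall>c\<in>A. \<forall>d\<in>A. x \<in> fst c \<longrightarrow> x \<in> fst d \<longrightarrow>
       v d = frechet_derivative (snd d \<circ> chart_inv c) (at (snd c x)) (v c))}"

definition tangent_atlas ::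
  "('m, 'e::euclidean_space) chart set \<Rightarrow> ('m \<times> ('m, 'e) tvec, 'e \<times> 'e) chart set"
  where "tangent_atlas A =
    (\<lambda>c. ({(x, v). x \<in> fst c \<and> v \<in> tangent_space A x}, \<lambda>(x, v). (snd c x, v c))) ` A"

definition chart_at :: "('m, 'e) chart set \<Rightarrow> 'm \<Rightarrow> ('m, 'e) chart"
  where "chart_at A x = (SOME c. c \<in> A \<and> x \<in> fst c)"

text \<open>The push-forward \<open>f\<^sub>* v\<close> of \<open>v \<in> T\<^sub>x A\<close>, computed in any chart around \<open>x\<close>; the derivative of a
  real function in direction \<open>v\<close>; and the velocity of a curve.\<close>

definition push ::
  "('m, 'e::euclidean_space) chart set \<Rightarrow> ('n, 'f::euclidean_space) chart set \<Rightarrow>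
   ('m \<Rightarrow> 'n) \<Rightarrow> 'm \<Rightarrow> ('m, 'e) tvec \<Rightarrow> ('n, 'f) tvec"
  where "push A B f x v = (\<lambda>d. if d \<in> B \<and> f x \<in> fst d
    then let c = chart_at A x in
      frechet_derivative (snd d \<circ> f \<circ> chart_inv c) (at (snd c x)) (v c)
    else 0)"

definition dir_deriv ::
  "('m, 'e::euclidean_space) chart set \<Rightarrow> ('m \<Rightarrow> real) \<Rightarrow> 'm \<Rightarrow> ('m, 'e) tvec \<Rightarrow> real"
  where "dir_deriv A f x v = (let c = chart_at A x in
    frechet_derivative (f \<circ> chart_inv c) (at (snd c x)) (v c))"

definition velocity ::
  "('m, 'e::euclidean_space) chart set \<Rightarrow> (real \<Rightarrow> 'm) \<Rightarrow> real \<Rightarrow> ('m, 'e) tvec"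
  where "velocity A \<gamma> t = (\<lambda>c. if c \<in> A \<and> \<gamma> t \<in> fst c
    then vector_derivative (snd c \<circ> \<gamma>) (at t) else 0)"

definition vector_field ::
  "('m, 'e::euclidean_space) chart set \<Rightarrow> ('m \<Rightarrow> ('m, 'e) tvec) \<Rightarrow> bool"
  where "vector_field A X \<longleftrightarrow>
    smooth_map_on A (tangent_atlas A) (carrier_of A) (\<lambda>x. (x, X x))"


section \<open>Riemannian metrics, almost complex structures, Levi-Civita connections\<close>

definition riemannian_metric ::
  "('m, 'e::euclidean_space) chart set \<Rightarrow> ('m \<Rightarrow> ('m, 'e) tvec \<Rightarrow> ('m, 'e) tvec \<Rightarrow> real) \<Rightarrow> bool"
  where "riemannian_metric A g \<longleftrightarrow>
    (\<forall>x\<in>carrier_of A. inner_product_on (tangent_space A x) (g x)) \<and>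
    (\<forall>X Y. vector_field A X \<longrightarrow> vector_field A Y \<longrightarrow>
       smooth_function A (\<lambda>x. g x (X x) (Y x)))"

definition linear_endomorphism :: "'a::real_vector set \<Rightarrow> ('a \<Rightarrow> 'a) \<Rightarrow> bool"
  where "linear_endomorphism V f \<longleftrightarrow> f ` V \<subseteq> V \<and> linear_on_space V f"

definition almost_complex_structure ::
  "('m, 'e::euclidean_space) chart set \<Rightarrow> ('m \<Rightarrow> ('m, 'e) tvec \<Rightarrow> ('m, 'e) tvec) \<Rightarrow> bool"
  where "almost_complex_structure A J \<longleftrightarrow>
    (\<forall>x\<in>carrier_of A. linear_endomorphism (tangent_space A x) (J x) \<and>
       (\<forall>v\<in>tangent_space A x. J x (J x v) = - v)) \<and>
    smooth_map_on (tangent_atlas A) (tangent_atlas A) (carrier_of (tangent_atlas A))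
      (\<lambda>(x, v). (x, J x v))"

text \<open>\<open>nabla x v Y\<close> is the covariant derivative at \<open>x\<close> of the vector field \<open>Y\<close> in direction
  \<open>v \<in> T\<^sub>x A\<close>.\<close>

type_synonym ('m, 'e) connection = "'m \<Rightarrow> ('m, 'e) tvec \<Rightarrow> ('m \<Rightarrow> ('m, 'e) tvec) \<Rightarrow> ('m, 'e) tvec"

definition affine_connection ::
  "('m, 'e::euclidean_space) chart set \<Rightarrow> ('m, 'e) connection \<Rightarrow> bool"
  where "affine_connection A nabla \<longleftrightarrow>
    (\<forall>x\<in>carrier_of A. \<forall>Y. vector_field A Y \<longrightarrow>
       (\<forall>v\<in>tangent_space A x. nabla x v Y \<in> tangent_space A x) \<and>
       linear_on_space (tangent_space A x) (\<lambda>v. nabla x v Y)) \<and>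
    (\<forall>x\<in>carrier_of A. \<forall>v\<in>tangent_space A x. \<forall>Y Z. vector_field A Y \<longrightarrow> vector_field A Z \<longrightarrow>
       nabla x v (\<lambda>y. Y y + Z y) = nabla x v Y + nabla x v Z) \<and>
    (\<forall>x\<in>carrier_of A. \<forall>v\<in>tangent_space A x. \<forall>f Y. smooth_function A f \<longrightarrow> vector_field A Y \<longrightarrow>
       nabla x v (\<lambda>y. f y *\<^sub>R Y y) = dir_deriv A f x v *\<^sub>R Y x + f x *\<^sub>R nabla x v Y) \<and>
    (\<forall>X Y. vector_field A X \<longrightarrow> vector_field A Y \<longrightarrow> vector_field A (\<lambda>x. nabla x (X x) Y))"

text \<open>Torsion-freeness \<open>\<nabla>\<^sub>X Y - \<nabla>\<^sub>Y X = [X, Y]\<close> is tested on smooth functions.\<close>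

definition levi_civita ::
  "('m, 'e::euclidean_space) chart set \<Rightarrow> ('m \<Rightarrow> ('m, 'e) tvec \<Rightarrow> ('m, 'e) tvec \<Rightarrow> real) \<Rightarrow>
   ('m, 'e) connection \<Rightarrow> bool"
  where "levi_civita A g nabla \<longleftrightarrow> affine_connection A nabla \<and>
    (\<forall>X Y f. vector_field A X \<longrightarrow> vector_field A Y \<longrightarrow> smooth_function A f \<longrightarrow>
       (\<forall>x\<in>carrier_of A. dir_deriv A f x (nabla x (X x) Y - nabla x (Y x) X) =
          dir_deriv A (\<lambda>y. dir_deriv A f y (Y y)) x (X x) -
          dir_deriv A (\<lambda>y. dir_deriv A f y (X y)) x (Y x))) \<and>
    (\<forall>Y Z. vector_field A Y \<longrightarrow> vector_field A Z \<longrightarrow>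
       (\<forall>x\<in>carrier_of A. \<forall>v\<in>tangent_space A x.
          dir_deriv A (\<lambda>y. g y (Y y) (Z y)) x v =
          g x (nabla x v Y) (Z x) + g x (Y x) (nabla x v Z)))"


section \<open>Submanifolds and their normal bundles\<close>

text \<open>From here on \<open>A\<close> is the atlas of the ambient manifold and \<open>B\<close> that of the submanifold, which is
  a subset of the ambient carrier with a manifold structure making the inclusion an immersion. The
  tangent spaces of the submanifold are identified with subspaces of the ambient ones through the
  derivative of the inclusion; the induced metric is then the restriction of \<open>g\<close>.\<close>

definition incl :: "('m, 'e::euclidean_space) chart set \<Rightarrow> ('m, 'f::euclidean_space) chart set \<Rightarrow>
    'm \<Rightarrow> ('m, 'f) tvec \<Rightarrow> ('m, 'e) tvec"
  where "incl A B x = push B A (\<lambda>y. y) x"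

definition submanifold ::
  "('m, 'e::euclidean_space) chart set \<Rightarrow> ('m, 'f::euclidean_space) chart set \<Rightarrow> bool"
  where "submanifold A B \<longleftrightarrow> smooth_manifold B \<and> carrier_of B \<subseteq> carrier_of A \<and>
    smooth_map_on B A (carrier_of B) (\<lambda>y. y) \<and>
    (\<forall>x\<in>carrier_of B. inj_on (incl A B x) (tangent_space B x))"

definition sub_tangent_space ::
  "('m, 'e::euclidean_space) chart set \<Rightarrow> ('m, 'f::euclidean_space) chart set \<Rightarrow>
   'm \<Rightarrow> ('m, 'e) tvec set"
  where "sub_tangent_space A B x = incl A B x ` tangent_space B x"

definition normal_fibre ::
  "('m, 'e::euclidean_space) chart set \<Rightarrow> ('m, 'f::euclidean_space) chart set \<Rightarrow>
   ('m \<Rightarrow> ('m, 'e) tvec \<Rightarrow> ('m, 'e) tvec \<Rightarrow> real) \<Rightarrow> 'm \<Rightarrow> ('m, 'e) tvec set"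
  where "normal_fibre A B g x =
    {w \<in> tangent_space A x. \<forall>v\<in>sub_tangent_space A B x. g x w v = 0}"

text \<open>\<open>T\<^sub>x M\<close> is the orthogonal direct sum of \<open>T\<^sub>x L\<close> and \<open>J (T\<^sub>x L)\<close>.\<close>

definition totally_real ::
  "('m, 'e::euclidean_space) chart set \<Rightarrow> ('m, 'f::euclidean_space) chart set \<Rightarrow>
   ('m \<Rightarrow> ('m, 'e) tvec \<Rightarrow> ('m, 'e) tvec \<Rightarrow> real) \<Rightarrow>
   ('m \<Rightarrow> ('m, 'e) tvec \<Rightarrow> ('m, 'e) tvec) \<Rightarrow> bool"
  where "totally_real A B g J \<longleftrightarrow> (\<forall>x\<in>carrier_of B.
    (\<forall>u\<in>sub_tangent_space A B x. \<forall>v\<in>J x ` sub_tangent_space A B x. g x u v = 0) \<and>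
    tangent_space A x =
      {u + v |u v. u \<in> sub_tangent_space A B x \<and> v \<in> J x ` sub_tangent_space A B x})"

definition normal_bundle ::
  "('m, 'e::euclidean_space) chart set \<Rightarrow> ('m, 'f::euclidean_space) chart set \<Rightarrow>
   ('m \<Rightarrow> ('m, 'e) tvec \<Rightarrow> ('m, 'e) tvec \<Rightarrow> real) \<Rightarrow> ('m \<times> ('m, 'e) tvec) set"
  where "normal_bundle A B g = {(x, \<theta>). x \<in> carrier_of B \<and> \<theta> \<in> normal_fibre A B g x}"

text \<open>A smooth frame of the normal bundle over an open set \<open>W\<close>, as a family of isomorphisms from the
  model space \<open>'f\<close>. The rank of the normal bundle equals the dimension of the submanifold here, which
  is why \<open>'f\<close> serves as model space of the fibres as well.\<close>

definition normal_frame ::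
  "('m, 'e::euclidean_space) chart set \<Rightarrow> ('m, 'f::euclidean_space) chart set \<Rightarrow>
   ('m \<Rightarrow> ('m, 'e) tvec \<Rightarrow> ('m, 'e) tvec \<Rightarrow> real) \<Rightarrow>
   'm set \<Rightarrow> ('m \<Rightarrow> 'f \<Rightarrow> ('m, 'e) tvec) \<Rightarrow> bool"
  where "normal_frame A B g W E \<longleftrightarrow>
    (\<forall>x\<in>W. linear (E x) \<and> bij_betw (E x) UNIV (normal_fibre A B g x)) \<and>
    (\<forall>a. smooth_map_on B (tangent_atlas A) W (\<lambda>x. (x, E x a)))"

text \<open>The vector bundle charts of the normal bundle: all local trivialisations by smooth frames.\<close>

definition normal_atlas ::
  "('m, 'e::euclidean_space) chart set \<Rightarrow> ('m, 'f::euclidean_space) chart set \<Rightarrow>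
   ('m \<Rightarrow> ('m, 'e) tvec \<Rightarrow> ('m, 'e) tvec \<Rightarrow> real) \<Rightarrow>
   ('m \<times> ('m, 'e) tvec, 'f \<times> 'f) chart set"
  where "normal_atlas A B g =
    {({(x, \<theta>). x \<in> W \<and> \<theta> \<in> normal_fibre A B g x}, \<lambda>(x, \<theta>). (snd c x, inv (E x) \<theta>)) |c W E.
       c \<in> B \<and> W \<subseteq> fst c \<and> openin (atlas_topology B) W \<and> normal_frame A B g W E}"

type_synonym ('m, 'e, 'f) ntvec = "('m \<times> ('m, 'e) tvec, 'f \<times> 'f) tvec"

definition normal_section ::
  "('m, 'e::euclidean_space) chart set \<Rightarrow> ('m, 'f::euclidean_space) chart set \<Rightarrow>
   ('m \<Rightarrow> ('m, 'e) tvec \<Rightarrow> ('m, 'e) tvec \<Rightarrow> real) \<Rightarrow> ('m \<Rightarrow> ('m, 'e) tvec) \<Rightarrow> bool"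
  where "normal_section A B g \<xi> \<longleftrightarrow>
    smooth_map_on B (normal_atlas A B g) (carrier_of B) (\<lambda>x. (x, \<xi> x))"

definition normal_part ::
  "('m, 'e::euclidean_space) chart set \<Rightarrow> ('m, 'f::euclidean_space) chart set \<Rightarrow>
   ('m \<Rightarrow> ('m, 'e) tvec \<Rightarrow> ('m, 'e) tvec \<Rightarrow> real) \<Rightarrow> 'm \<Rightarrow> ('m, 'e) tvec \<Rightarrow> ('m, 'e) tvec"
  where "normal_part A B g x w =
    (THE n. n \<in> normal_fibre A B g x \<and> w - n \<in> sub_tangent_space A B x)"

text \<open>The normal connection \<open>\<nabla>\<^sup>\<bottom>\<^sub>u \<xi>\<close>, for \<open>u \<in> T\<^sub>x L\<close>, is the normal part of the ambient covariant
  derivative of any vector field extending the normal section \<open>\<xi>\<close> near \<open>x\<close>.\<close>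

definition normal_connection ::
  "('m, 'e::euclidean_space) chart set \<Rightarrow> ('m, 'f::euclidean_space) chart set \<Rightarrow>
   ('m \<Rightarrow> ('m, 'e) tvec \<Rightarrow> ('m, 'e) tvec \<Rightarrow> real) \<Rightarrow> ('m, 'e) connection \<Rightarrow>
   'm \<Rightarrow> ('m, 'f) tvec \<Rightarrow> ('m \<Rightarrow> ('m, 'e) tvec) \<Rightarrow> ('m, 'e) tvec"
  where "normal_connection A B g nabla x u \<xi> =
    (THE w. \<exists>Y W. vector_field A Y \<and> openin (atlas_topology B) W \<and> x \<in> W \<and>
       (\<forall>y\<in>W. Y y = \<xi> y) \<and> w = normal_part A B g x (nabla x (incl A B x u) Y))"

text \<open>\<open>K\<close> is a smooth bundle morphism over \<open>\<pi>\<close>, restricts to the canonical isomorphism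
  \<open>T\<^sub>\<theta>(T\<^sup>\<bottom>\<^sub>x L) \<cong> T\<^sup>\<bottom>\<^sub>x L\<close> (identifying the velocity of \<open>t \<mapsto> \<theta> + t \<xi>\<close> with \<open>\<xi>\<close>), and satisfies
  \<open>K (\<xi>\<^sub>* u) = \<nabla>\<^sup>\<bottom>\<^sub>u \<xi>\<close>.\<close>

definition connection_map ::
  "('m, 'e::euclidean_space) chart set \<Rightarrow> ('m, 'f::euclidean_space) chart set \<Rightarrow>
   ('m \<Rightarrow> ('m, 'e) tvec \<Rightarrow> ('m, 'e) tvec \<Rightarrow> real) \<Rightarrow> ('m, 'e) connection \<Rightarrow>
   ('m \<times> ('m, 'e) tvec \<Rightarrow> ('m, 'e, 'f) ntvec \<Rightarrow> ('m, 'e) tvec) \<Rightarrow> bool"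
  where "connection_map A B g nabla K \<longleftrightarrow>
    (\<forall>(x, \<theta>)\<in>normal_bundle A B g.
       K (x, \<theta>) ` tangent_space (normal_atlas A B g) (x, \<theta>) \<subseteq> normal_fibre A B g x \<and>
       linear_on_space (tangent_space (normal_atlas A B g) (x, \<theta>)) (K (x, \<theta>)) \<and>
       (\<forall>\<xi>\<in>normal_fibre A B g x.
          K (x, \<theta>) (velocity (normal_atlas A B g) (\<lambda>t. (x, \<theta> + t *\<^sub>R \<xi>)) 0) = \<xi>)) \<and>
    smooth_map_on (tangent_atlas (normal_atlas A B g)) (normal_atlas A B g)
      (carrier_of (tangent_atlas (normal_atlas A B g))) (\<lambda>(z, a). (fst z, K z a)) \<and>
    (\<forall>\<xi>. normal_section A B g \<xi> \<longrightarrow> (\<forall>x\<in>carrier_of B. \<forall>u\<in>tangent_space B x.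
       K (x, \<xi> x) (push B (normal_atlas A B g) (\<lambda>y. (y, \<xi> y)) x u) =
       normal_connection A B g nabla x u \<xi>))"


section \<open>The $(p,q)$-metric and the almost complex structure on the normal bundle\<close>

text \<open>The derivative \<open>\<pi>\<^sub>*\<close> of the bundle projection at \<open>z = (x, \<theta>)\<close>, with values in
  \<open>T\<^sub>x L \<subseteq> T\<^sub>x M\<close>.\<close>

definition pi_push ::
  "('m, 'e::euclidean_space) chart set \<Rightarrow> ('m, 'f::euclidean_space) chart set \<Rightarrow>
   ('m \<Rightarrow> ('m, 'e) tvec \<Rightarrow> ('m, 'e) tvec \<Rightarrow> real) \<Rightarrow>
   'm \<times> ('m, 'e) tvec \<Rightarrow> ('m, 'e, 'f) ntvec \<Rightarrow> ('m, 'e) tvec"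
  where "pi_push A B g z a = incl A B (fst z) (push (normal_atlas A B g) B fst z a)"

definition horizontal_lift ::
  "('m, 'e::euclidean_space) chart set \<Rightarrow> ('m, 'f::euclidean_space) chart set \<Rightarrow>
   ('m \<Rightarrow> ('m, 'e) tvec \<Rightarrow> ('m, 'e) tvec \<Rightarrow> real) \<Rightarrow>
   ('m \<times> ('m, 'e) tvec \<Rightarrow> ('m, 'e, 'f) ntvec \<Rightarrow> ('m, 'e) tvec) \<Rightarrow>
   'm \<times> ('m, 'e) tvec \<Rightarrow> ('m, 'e) tvec \<Rightarrow> ('m, 'e, 'f) ntvec"
  where "horizontal_lift A B g K z X =
    (THE a. a \<in> tangent_space (normal_atlas A B g) z \<and> K z a = 0 \<and> pi_push A B g z a = X)"

definition vertical_lift ::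
  "('m, 'e::euclidean_space) chart set \<Rightarrow> ('m, 'f::euclidean_space) chart set \<Rightarrow>
   ('m \<Rightarrow> ('m, 'e) tvec \<Rightarrow> ('m, 'e) tvec \<Rightarrow> real) \<Rightarrow>
   ('m \<times> ('m, 'e) tvec \<Rightarrow> ('m, 'e, 'f) ntvec \<Rightarrow> ('m, 'e) tvec) \<Rightarrow>
   'm \<times> ('m, 'e) tvec \<Rightarrow> ('m, 'e) tvec \<Rightarrow> ('m, 'e, 'f) ntvec"
  where "vertical_lift A B g K z \<xi> =
    (THE a. a \<in> tangent_space (normal_atlas A B g) z \<and> pi_push A B g z a = 0 \<and> K z a = \<xi>)"

definition sq_norm ::
  "('m \<Rightarrow> ('m, 'e) tvec \<Rightarrow> ('m, 'e) tvec \<Rightarrow> real) \<Rightarrow> 'm \<times> ('m, 'e) tvec \<Rightarrow> real"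
  where "sq_norm g z = g (fst z) (snd z) (snd z)"

definition omega ::
  "('m \<Rightarrow> ('m, 'e) tvec \<Rightarrow> ('m, 'e) tvec \<Rightarrow> real) \<Rightarrow> 'm \<times> ('m, 'e) tvec \<Rightarrow> real"
  where "omega g z = 1 / (1 + sq_norm g z)"

definition pq_metric ::
  "('m, 'e::euclidean_space) chart set \<Rightarrow> ('m, 'f::euclidean_space) chart set \<Rightarrow>
   ('m \<Rightarrow> ('m, 'e) tvec \<Rightarrow> ('m, 'e) tvec \<Rightarrow> real) \<Rightarrow>
   ('m \<times> ('m, 'e) tvec \<Rightarrow> ('m, 'e, 'f) ntvec \<Rightarrow> ('m, 'e) tvec) \<Rightarrow> real \<Rightarrow> real \<Rightarrow>
   'm \<times> ('m, 'e) tvec \<Rightarrow> ('m, 'e, 'f) ntvec \<Rightarrow> ('m, 'e, 'f) ntvec \<Rightarrow> real"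
  where "pq_metric A B g K p q z a b = (let x = fst z; \<theta> = snd z in
    g x (pi_push A B g z a) (pi_push A B g z b) +
    omega g z powr p * (g x (K z a) (K z b) + q * g x (K z a) \<theta> * g x (K z b) \<theta>))"

text \<open>The prescribed values of \<open>\<tilde>J\<close> on the vertical lift of \<open>\<xi>\<close> and on the horizontal lift of \<open>X\<close>.\<close>

definition Jt_vertical ::
  "('m, 'e::euclidean_space) chart set \<Rightarrow> ('m, 'f::euclidean_space) chart set \<Rightarrow>
   ('m \<Rightarrow> ('m, 'e) tvec \<Rightarrow> ('m, 'e) tvec \<Rightarrow> real) \<Rightarrow>
   ('m \<Rightarrow> ('m, 'e) tvec \<Rightarrow> ('m, 'e) tvec) \<Rightarrow>
   ('m \<times> ('m, 'e) tvec \<Rightarrow> ('m, 'e, 'f) ntvec \<Rightarrow> ('m, 'e) tvec) \<Rightarrow> real \<Rightarrow> real \<Rightarrow>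
   'm \<times> ('m, 'e) tvec \<Rightarrow> ('m, 'e) tvec \<Rightarrow> ('m, 'e, 'f) ntvec"
  where "Jt_vertical A B g J K p q z \<xi> = (let x = fst z; \<theta> = snd z in
    (omega g z powr (p / 2)) *\<^sub>R
      (horizontal_lift A B g K z (J x \<xi>) +
       (q / (1 + sqrt (1 + q * sq_norm g z)) * g x \<xi> \<theta>) *\<^sub>R horizontal_lift A B g K z (J x \<theta>)))"

definition Jt_horizontal ::
  "('m, 'e::euclidean_space) chart set \<Rightarrow> ('m, 'f::euclidean_space) chart set \<Rightarrow>
   ('m \<Rightarrow> ('m, 'e) tvec \<Rightarrow> ('m, 'e) tvec \<Rightarrow> real) \<Rightarrow>
   ('m \<Rightarrow> ('m, 'e) tvec \<Rightarrow> ('m, 'e) tvec) \<Rightarrow>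
   ('m \<times> ('m, 'e) tvec \<Rightarrow> ('m, 'e, 'f) ntvec \<Rightarrow> ('m, 'e) tvec) \<Rightarrow> real \<Rightarrow> real \<Rightarrow>
   'm \<times> ('m, 'e) tvec \<Rightarrow> ('m, 'e) tvec \<Rightarrow> ('m, 'e, 'f) ntvec"
  where "Jt_horizontal A B g J K p q z X = (let x = fst z; \<theta> = snd z in
    (1 / omega g z powr (p / 2)) *\<^sub>R
      (vertical_lift A B g K z (J x X) -
       (q / (1 + q * sq_norm g z + sqrt (1 + q * sq_norm g z)) * g x (J x X) \<theta>) *\<^sub>R
         vertical_lift A B g K z \<theta>))"

text \<open>Every tangent vector \<open>a\<close> of the normal bundle is the sum of the vertical lift of \<open>K a\<close> and the
  horizontal lift of \<open>\<pi>\<^sub>* a\<close>, which gives the linear extension.\<close>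

definition Jt ::
  "('m, 'e::euclidean_space) chart set \<Rightarrow> ('m, 'f::euclidean_space) chart set \<Rightarrow>
   ('m \<Rightarrow> ('m, 'e) tvec \<Rightarrow> ('m, 'e) tvec \<Rightarrow> real) \<Rightarrow>
   ('m \<Rightarrow> ('m, 'e) tvec \<Rightarrow> ('m, 'e) tvec) \<Rightarrow>
   ('m \<times> ('m, 'e) tvec \<Rightarrow> ('m, 'e, 'f) ntvec \<Rightarrow> ('m, 'e) tvec) \<Rightarrow> real \<Rightarrow> real \<Rightarrow>
   'm \<times> ('m, 'e) tvec \<Rightarrow> ('m, 'e, 'f) ntvec \<Rightarrow> ('m, 'e, 'f) ntvec"
  where "Jt A B g J K p q z a =
    Jt_vertical A B g J K p q z (K z a) + Jt_horizontal A B g J K p q z (pi_push A B g z a)"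

end

theory Submission
  imports Defs
begin

text \<open>
  At \<open>z = (x, \<theta>)\<close> the map \<open>(\<pi>\<^sub>*, K)\<close> identifies the tangent space of the normal bundle with
  \<open>T\<^sub>x L \<times> T\<^sub>x\<^sup>\<bottom> L\<close>: vertical vectors are exactly the kernel of \<open>\<pi>\<^sub>*\<close>, and \<open>K\<close> is the canonical
  isomorphism on them. Under this identification \<open>J~\<close> exchanges the two factors by
  \<open>\<xi> \<mapsto> \<omega> (J \<xi> + c \<langle>\<xi>, \<theta>\<rangle> J \<theta>)\<close> and \<open>X \<mapsto> \<omega>\<^sup>-\<^sup>1 (J X - c' \<langle>J X, \<theta>\<rangle> \<theta>)\<close>, where \<open>\<omega>\<close> stands for
  \<open>\<omega>\<^sub>\<theta>\<close> to the power \<open>p / 2\<close>. With \<open>\<sigma> = \<langle>\<theta>, \<theta>\<rangle>\<close> and \<open>\<rho> = \<surd>(1 + q \<sigma>)\<close>, everything reduces to the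
  scalar identities \<open>c - c' - c c' \<sigma> = 0\<close>, \<open>2 c + c\<^sup>2 \<sigma> = q\<close> and
  \<open>q (1 - c' \<sigma>)\<^sup>2 + c'\<^sup>2 \<sigma> - 2 c' = 0\<close>.
  That the transition maps of the normal bundle are differentiable comes from solving
  \<open>M(y) G(y) = v(y)\<close> for \<open>G\<close>, with \<open>M(y)\<close> injective linear at the point in question.
\<close>

section \<open>Solutions of linear equations depending on a parameter\<close>

lemma smooth_on_differentiable:
  assumes "smooth_on S f" and "x \<in> S"
  shows "f differentiable (at x)"
  using assms unfolding smooth_on_def by (metis Ck_on.simps(2))

lemma differentiable_transform_eventually:
  assumes "f differentiable (at a)" and "\<forall>\<^sub>F y in nhds a. f y = g y"
  shows "g differentiable (at a)"
proof -
  obtain D where "(f has_derivative D) (at a)"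
    using assms(1) by (auto simp: differentiable_def)
  then have "(g has_derivative D) (at a)"
    using eventually_nhds_x_imp_x[OF assms(2)] assms(2)
    by (auto elim!: has_derivative_transform_eventually simp: eventually_nhds_conv_at)
  then show ?thesis
    by (auto simp: differentiable_def)
qed

text \<open>Continuity of the scalar factor suffices because the vector factor vanishes at
  \<open>a\<close>: the error \<open>(\<phi> y - \<phi> a) *\<^sub>R D (y - a)\<close> is of smaller
  order than \<open>norm (y - a)\<close>. This upgrades continuity of a solution to
  differentiability in the lemma on linear equations below.\<close>

lemma differentiable_scaleR_zero:
  fixes \<phi> :: "'a::real_normed_vector \<Rightarrow> real" and \<psi> :: "'a \<Rightarrow> 'b::real_normed_vector"
  assumes "isCont \<phi> a" and "\<psi> differentiable (at a)" and "\<psi> a = 0"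
  shows "(\<lambda>y. \<phi> y *\<^sub>R \<psi> y) differentiable (at a)"
proof -
  obtain D where D: "(\<psi> has_derivative D) (at a)"
    using assms(2) by (auto simp: differentiable_def)
  have bl: "bounded_linear D"
    using D by (rule has_derivative_bounded_linear)
  have err: "((\<lambda>y. (\<psi> y - D (y - a)) /\<^sub>R norm (y - a)) \<longlongrightarrow> 0) (at a)"
    using D assms(3) by (simp add: has_derivative_at_within)
  have rem: "((\<lambda>y. (\<phi> y - \<phi> a) *\<^sub>R (D (y - a) /\<^sub>R norm (y - a))) \<longlongrightarrow> 0) (at a)"
  proof (rule Lim_null_comparison)
    show "\<forall>\<^sub>F y in at a. norm ((\<phi> y - \<phi> a) *\<^sub>R (D (y - a) /\<^sub>R norm (y - a))) \<le>
        \<bar>\<phi> y - \<phi> a\<bar> * onorm D"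
    proof (rule always_eventually, rule allI)
      fix y
      have "norm (D (y - a)) / norm (y - a) \<le> onorm D"
        by (rule le_onorm[OF bl])
      then show "norm ((\<phi> y - \<phi> a) *\<^sub>R (D (y - a) /\<^sub>R norm (y - a))) \<le> \<bar>\<phi> y - \<phi> a\<bar> * onorm D"
        using mult_right_mono[of "norm (D (y - a)) / norm (y - a)" "onorm D" "\<bar>\<phi> y - \<phi> a\<bar>"]
        by (simp add: divide_inverse abs_mult mult_ac)
    qed
    have "(\<phi> \<longlongrightarrow> \<phi> a) (at a)"
      using assms(1) by (simp add: isCont_def)
    then show "((\<lambda>y. \<bar>\<phi> y - \<phi> a\<bar> * onorm D) \<longlongrightarrow> 0) (at a)"
      by (auto intro!: tendsto_mult_left_zero tendsto_rabs_zero simp: LIM_zero_iff)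
  qed
  \<comment> \<open>The difference quotient splits into \<open>\<phi>\<close> times the remainder of
    \<open>\<psi>\<close> and the product of a null term with a bounded one.\<close>
  have "((\<lambda>y. \<phi> y *\<^sub>R ((\<psi> y - D (y - a)) /\<^sub>R norm (y - a)) +
      (\<phi> y - \<phi> a) *\<^sub>R (D (y - a) /\<^sub>R norm (y - a))) \<longlongrightarrow> \<phi> a *\<^sub>R 0 + 0) (at a)"
    using assms(1) by (intro tendsto_add tendsto_scaleR err rem) (simp add: isCont_def)
  moreover have "\<phi> y *\<^sub>R ((\<psi> y - D (y - a)) /\<^sub>R norm (y - a)) +
      (\<phi> y - \<phi> a) *\<^sub>R (D (y - a) /\<^sub>R norm (y - a)) =
      (\<phi> y *\<^sub>R \<psi> y - \<phi> a *\<^sub>R \<psi> a - \<phi> a *\<^sub>R D (y - a)) /\<^sub>R norm (y - a)" for y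
    using assms(3) by (simp add: algebra_simps)
  ultimately have "((\<lambda>y. \<phi> y *\<^sub>R \<psi> y) has_derivative (\<lambda>h. \<phi> a *\<^sub>R D h)) (at a)"
    using bl by (simp add: has_derivative_at_within bounded_linear_const_scaleR)
  then show ?thesis
    by (auto simp: differentiable_def)
qed

lemma linear_sum_Basis:
  fixes f :: "'a::euclidean_space \<Rightarrow> 'b::real_vector"
  assumes "linear f"
  shows "f h = (\<Sum>b\<in>Basis. (h \<bullet> b) *\<^sub>R f b)"
proof -
  have "f h = f (\<Sum>b\<in>Basis. (h \<bullet> b) *\<^sub>R b)"
    by (simp add: euclidean_representation)
  then show ?thesis
    using assms by (simp add: linear_sum linear_cmul)
qed

text \<open>A left inverse of \<open>M a\<close> turns the equation into a perturbation of the
  identity whose perturbation vanishes at \<open>a\<close>. An a priori bound gives continuity of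
  \<open>G\<close> at \<open>a\<close>, and continuity is then improved to
  differentiability.\<close>

lemma differentiable_linear_equation_solution:
  fixes M :: "'a::euclidean_space \<Rightarrow> 'b::euclidean_space \<Rightarrow> 'c::euclidean_space"
  assumes lin: "\<forall>\<^sub>F y in nhds a. linear (M y)" and inj: "inj (M a)"
    and M: "\<And>b. (\<lambda>y. M y b) differentiable (at a)"
    and v: "v differentiable (at a)"
    and eq: "\<forall>\<^sub>F y in nhds a. M y (G y) = v y"
  shows "G differentiable (at a)"
proof -
  obtain L where L: "linear L" "L \<circ> M a = id"
    using linear_injective_left_inverse eventually_nhds_x_imp_x[OF lin] inj by blast
  \<comment> \<open>\<open>R y\<close> measures how far \<open>L \<circ> M y\<close> is from the
    identity. Since it vanishes at \<open>a\<close>, the equation becomes a fixed point equation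
    that makes \<open>G\<close> a small perturbation of \<open>u\<close>.\<close>
  define R where "R y b = L (M y b) - b" for y and b :: 'b
  define u where "u y = L (v y)" for y
  have bL: "L differentiable F" for F
    using L(1) linear_imp_differentiable by blast
  have R: "R a b = 0" "(\<lambda>y. R y b) differentiable (at a)" for b
  proof -
    show "R a b = 0"
      using L(2) by (simp add: R_def fun_eq_iff)
    have "(\<lambda>y. L (M y b)) differentiable (at a)"
      using differentiable_chain_at[OF M bL] by (simp add: o_def)
    then show "(\<lambda>y. R y b) differentiable (at a)"
      unfolding R_def by (intro differentiable_diff differentiable_const)
  qed
  have u: "u differentiable (at a)"
    using differentiable_chain_at[OF v bL] by (simp add: o_def u_def[abs_def])
  have G: "\<forall>\<^sub>F y in nhds a. G y = u y - (\<Sum>b\<in>Basis. (G y \<bullet> b) *\<^sub>R R y b)"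
    using lin eq
  proof eventually_elim
    case (elim y)
    have "linear (\<lambda>h. L (M y h))"
      using linear_compose[OF elim(1) L(1)] by (simp add: o_def)
    from linear_sum_Basis[OF this, of "G y"]
    have "u y = (\<Sum>b\<in>Basis. (G y \<bullet> b) *\<^sub>R L (M y b))"
      by (simp add: u_def elim(2))
    moreover have "G y = (\<Sum>b\<in>Basis. (G y \<bullet> b) *\<^sub>R b)"
      by (simp add: euclidean_representation)
    ultimately show ?case
      unfolding R_def scaleR_diff_right sum_subtractf by simp
  qed
  define \<rho> where "\<rho> y = (\<Sum>b\<in>Basis. norm (R y b))" for y
  have contR: "isCont (\<lambda>y. R y b) a" and contu: "isCont u a" for b
    using R(2) u differentiable_imp_continuous_within by blast+
  have \<rho>: "(\<rho> \<longlongrightarrow> 0) (at a)"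
  proof -
    have "isCont \<rho> a"
      unfolding \<rho>_def[abs_def] by (intro continuous_intros contR)
    then show ?thesis
      by (simp add: isCont_def \<rho>_def R(1))
  qed
  have bound: "norm (G y - u y) \<le> norm (G y) * \<rho> y"
    if "G y = u y - (\<Sum>b\<in>Basis. (G y \<bullet> b) *\<^sub>R R y b)" for y
  proof -
    have "norm (G y - u y) = norm (\<Sum>b\<in>Basis. (G y \<bullet> b) *\<^sub>R R y b)"
      by (subst that) simp
    also have "\<dots> \<le> (\<Sum>b\<in>Basis. norm ((G y \<bullet> b) *\<^sub>R R y b))"
      by (rule norm_sum)
    also have "\<dots> \<le> (\<Sum>b\<in>Basis. norm (G y) * norm (R y b))"
      by (intro sum_mono) (simp add: Basis_le_norm mult_right_mono)
    finally show ?thesis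
      by (simp add: \<rho>_def sum_distrib_left)
  qed
  have "((\<lambda>y. G y - u y) \<longlongrightarrow> 0) (at a)"
  proof (rule Lim_null_comparison)
    have "\<forall>\<^sub>F y in at a. G y = u y - (\<Sum>b\<in>Basis. (G y \<bullet> b) *\<^sub>R R y b)"
      using G by (simp add: eventually_nhds_conv_at)
    \<comment> \<open>Once \<open>\<rho> y\<close> is below 1/2, the term
      \<open>norm (G y) * \<rho> y\<close> can be absorbed. This bounds \<open>G\<close> by
      \<open>2 * norm (u y)\<close> before anything is known about its continuity.\<close>
    moreover have "\<forall>\<^sub>F y in at a. \<rho> y < 1/2"
      using \<rho> by (rule order_tendstoD) simp
    ultimately show "\<forall>\<^sub>F y in at a. norm (G y - u y) \<le> 2 * norm (u y) * \<rho> y"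
    proof eventually_elim
      case (elim y)
      have \<rho>0: "0 \<le> \<rho> y"
        by (simp add: \<rho>_def sum_nonneg)
      have "norm (G y) \<le> norm (u y) + norm (G y - u y)"
        by (rule norm_triangle_sub)
      also have "norm (G y - u y) \<le> norm (G y) * (1/2)"
        using bound[OF elim(1)] mult_left_mono[of "\<rho> y" "1/2" "norm (G y)"] elim(2) by simp
      finally have "norm (G y) \<le> 2 * norm (u y)"
        by simp
      then show ?case
        using bound[OF elim(1)] mult_right_mono[OF _ \<rho>0] by fastforce
    qed
    have "((\<lambda>y. 2 * norm (u y) * \<rho> y) \<longlongrightarrow> 2 * norm (u a) * 0) (at a)"
      using contu by (intro tendsto_intros \<rho>) (simp add: isCont_def)
    then show "((\<lambda>y. 2 * norm (u y) * \<rho> y) \<longlongrightarrow> 0) (at a)"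
      by simp
  qed
  then have "((\<lambda>y. (G y - u y) + u y) \<longlongrightarrow> 0 + u a) (at a)"
    using contu by (intro tendsto_add) (simp_all add: isCont_def)
  moreover have "G a = u a"
    using eventually_nhds_x_imp_x[OF G] by (simp add: R(1))
  ultimately have contG: "isCont G a"
    by (simp add: isCont_def)
  \<comment> \<open>With continuity of \<open>G\<close> at hand, each summand is a continuous
    coefficient times a differentiable map that vanishes at \<open>a\<close>.\<close>
  have "(\<lambda>y. u y - (\<Sum>b\<in>Basis. (G y \<bullet> b) *\<^sub>R R y b)) differentiable (at a)"
    by (intro differentiable_diff differentiable_sum u differentiable_scaleR_zero R
        continuous_intros contG ballI) auto
  then show ?thesis
    by (rule differentiable_transform_eventually) (use G in \<open>simp add: eq_commute\<close>)
qed


section \<open>Tangent spaces and push-forwards at a point\<close>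

lemma chart_inv_eq:
  assumes "inj_on (snd c) (fst c)" and "y \<in> fst c"
  shows "chart_inv c (snd c y) = y"
  using assms by (simp add: chart_inv_def)

text \<open>Isolates what first derivatives at one point use of \<open>smooth_manifold\<close>. The
  same lemmas then serve \<open>A\<close>, \<open>B\<close> and the atlas of the normal bundle, for
  which exactly this pointwise form is proved.\<close>

definition differentiable_atlas_at :: "('m, 'e::euclidean_space) chart set \<Rightarrow> 'm \<Rightarrow> bool"
  where "differentiable_atlas_at A x \<longleftrightarrow>
    (\<forall>c\<in>A. x \<in> fst c \<longrightarrow> inj_on (snd c) (fst c)) \<and>
    (\<forall>c\<in>A. \<forall>d\<in>A. x \<in> fst c \<longrightarrow> x \<in> fst d \<longrightarrow>
      (\<forall>\<^sub>F y in nhds (snd c x). y \<in> snd c ` (fst c \<inter> fst d)) \<and>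
      (snd d \<circ> chart_inv c) differentiable (at (snd c x)))"

definition differentiable_map_at ::
  "('m, 'e::euclidean_space) chart set \<Rightarrow> ('n, 'f::euclidean_space) chart set \<Rightarrow>
   ('m \<Rightarrow> 'n) \<Rightarrow> 'm \<Rightarrow> bool"
  where "differentiable_map_at A B f x \<longleftrightarrow>
    (\<forall>c\<in>A. \<forall>d\<in>B. x \<in> fst c \<longrightarrow> f x \<in> fst d \<longrightarrow>
      (\<forall>\<^sub>F y in nhds (snd c x). f (chart_inv c y) \<in> fst d) \<and>
      (snd d \<circ> f \<circ> chart_inv c) differentiable (at (snd c x)))"

lemma differentiable_map_atD:
  assumes "differentiable_map_at A B f x" and "c \<in> A" "d \<in> B" "x \<in> fst c" "f x \<in> fst d"
  shows "\<forall>\<^sub>F y in nhds (snd c x). f (chart_inv c y) \<in> fst d"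
    and "(snd d \<circ> f \<circ> chart_inv c) differentiable (at (snd c x))"
  using assms by (simp_all add: differentiable_map_at_def)

lemma smooth_manifold_differentiable_atlas_at:
  assumes "smooth_manifold A"
  shows "differentiable_atlas_at A x"
  unfolding differentiable_atlas_at_def
proof (intro conjI ballI impI)
  fix c d assume cd: "c \<in> A" "d \<in> A" "x \<in> fst c" "x \<in> fst d"
  have x: "snd c x \<in> snd c ` (fst c \<inter> fst d)"
    using cd by blast
  have "open (snd c ` (fst c \<inter> fst d))"
    and s: "smooth_on (snd c ` (fst c \<inter> fst d)) (snd d \<circ> chart_inv c)"
    using assms cd(1,2) unfolding smooth_manifold_def by blast+
  then show "\<forall>\<^sub>F y in nhds (snd c x). y \<in> snd c ` (fst c \<inter> fst d)"
    using x by (rule_tac eventually_nhds_in_open)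
  show "(snd d \<circ> chart_inv c) differentiable (at (snd c x))"
    by (rule smooth_on_differentiable[OF s x])
qed (use assms in \<open>auto simp: smooth_manifold_def\<close>)

lemma smooth_map_on_differentiable_map_at:
  assumes "smooth_manifold A" and "smooth_map_on A B S f" and "x \<in> S"
  shows "differentiable_map_at A B f x"
  unfolding differentiable_map_at_def
proof (intro conjI ballI impI)
  fix c d assume cd: "c \<in> A" "d \<in> B" "x \<in> fst c" "f x \<in> fst d"
  have inj: "inj_on (snd c) (fst c)"
    using assms(1) cd by (auto simp: smooth_manifold_def)
  let ?D = "snd c ` {x \<in> S \<inter> fst c. f x \<in> fst d}"
  have op: "open ?D" and s: "smooth_on ?D (snd d \<circ> f \<circ> chart_inv c)"
    using assms(2) cd(1,2) unfolding smooth_map_on_def Let_def by blast+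
  have x: "snd c x \<in> ?D"
    using cd assms(3) by blast
  show "(snd d \<circ> f \<circ> chart_inv c) differentiable (at (snd c x))"
    by (rule smooth_on_differentiable[OF s x])
  have "\<forall>\<^sub>F y in nhds (snd c x). y \<in> ?D"
    using op x by (rule eventually_nhds_in_open)
  then show "\<forall>\<^sub>F y in nhds (snd c x). f (chart_inv c y) \<in> fst d"
    by eventually_elim (auto simp: chart_inv_eq[OF inj])
qed

text \<open>Chain rule for \<open>snd e \<circ> f \<circ> chart_inv c\<close> factored through the
  chart \<open>d\<close>. The factorisation holds near \<open>snd c x\<close>, where
  \<open>f \<circ> chart_inv c\<close> stays in the domain of \<open>d\<close>.\<close>

lemma frechet_derivative_chart_change:
  assumes B: "differentiable_atlas_at B (f x)" and de: "d \<in> B" "e \<in> B" "f x \<in> fst d" "f x \<in> fst e"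
    and c: "chart_inv c (snd c x) = x"
    and f: "\<forall>\<^sub>F y in nhds (snd c x). f (chart_inv c y) \<in> fst d"
      "(snd d \<circ> f \<circ> chart_inv c) differentiable (at (snd c x))"
  shows "frechet_derivative (snd e \<circ> f \<circ> chart_inv c) (at (snd c x)) w =
    frechet_derivative (snd e \<circ> chart_inv d) (at (snd d (f x)))
      (frechet_derivative (snd d \<circ> f \<circ> chart_inv c) (at (snd c x)) w)"
proof -
  have inj: "inj_on (snd d) (fst d)"
    and df: "(snd e \<circ> chart_inv d) differentiable (at (snd d (f x)))"
    using B de unfolding differentiable_atlas_at_def by blast+
  have "((snd e \<circ> chart_inv d) \<circ> (snd d \<circ> f \<circ> chart_inv c) has_derivative
      frechet_derivative (snd e \<circ> chart_inv d) (at (snd d (f x))) \<circ>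
      frechet_derivative (snd d \<circ> f \<circ> chart_inv c) (at (snd c x))) (at (snd c x))"
    using df f(2) by (intro diff_chain_at) (simp_all add: c frechet_derivative_works[symmetric])
  then have "(snd e \<circ> f \<circ> chart_inv c has_derivative
      frechet_derivative (snd e \<circ> chart_inv d) (at (snd d (f x))) \<circ>
      frechet_derivative (snd d \<circ> f \<circ> chart_inv c) (at (snd c x))) (at (snd c x))"
  proof (rule has_derivative_transform_eventually)
    have "\<forall>\<^sub>F y in at (snd c x). f (chart_inv c y) \<in> fst d"
      using f(1) by (simp add: eventually_nhds_conv_at)
    then show "\<forall>\<^sub>F y in at (snd c x). ((snd e \<circ> chart_inv d) \<circ> (snd d \<circ> f \<circ> chart_inv c)) y =
        (snd e \<circ> f \<circ> chart_inv c) y"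
      by eventually_elim (simp add: chart_inv_eq[OF inj])
  qed (simp_all add: c chart_inv_eq[OF inj] de)
  then show ?thesis
    using frechet_derivative_at[symmetric] by (metis comp_apply)
qed

lemma linear_frechet_derivative_transition:
  assumes "differentiable_atlas_at A x" and "c \<in> A" "d \<in> A" "x \<in> fst c" "x \<in> fst d"
  shows "linear (frechet_derivative (snd d \<circ> chart_inv c) (at (snd c x)))"
  using assms unfolding differentiable_atlas_at_def by (blast intro: linear_frechet_derivative)

lemma frechet_derivative_transition_cocycle:
  assumes A: "differentiable_atlas_at A x"
    and c: "c \<in> A" "x \<in> fst c" and d: "d \<in> A" "x \<in> fst d" and e: "e \<in> A" "x \<in> fst e"
  shows "frechet_derivative (snd e \<circ> chart_inv d) (at (snd d x))
      (frechet_derivative (snd d \<circ> chart_inv c) (at (snd c x)) w) =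
    frechet_derivative (snd e \<circ> chart_inv c) (at (snd c x)) w"
proof -
  have inj: "inj_on (snd c) (fst c)" and df: "(snd d \<circ> chart_inv c) differentiable (at (snd c x))"
    and "\<forall>\<^sub>F y in nhds (snd c x). y \<in> snd c ` (fst c \<inter> fst d)"
    using A c d unfolding differentiable_atlas_at_def by blast+
  from this(3) have "\<forall>\<^sub>F y in nhds (snd c x). chart_inv c y \<in> fst d"
    by eventually_elim (auto simp: chart_inv_eq[OF inj])
  then show ?thesis
    using frechet_derivative_chart_change[of A "\<lambda>y. y" x d e c] A c d e df
    by (simp add: chart_inv_eq[OF inj] o_def)
qed

text \<open>The map is the identity on the image of the chart, and this image is a neighbourhood of
  the point.\<close>

lemma frechet_derivative_transition_self:
  assumes A: "differentiable_atlas_at A x" and c: "c \<in> A" "x \<in> fst c"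
  shows "frechet_derivative (snd c \<circ> chart_inv c) (at (snd c x)) w = w"
proof -
  have inj: "inj_on (snd c) (fst c)" and "\<forall>\<^sub>F y in nhds (snd c x). y \<in> snd c ` (fst c \<inter> fst c)"
    using A c unfolding differentiable_atlas_at_def by blast+
  from this(2) have "\<forall>\<^sub>F y in at (snd c x). y \<in> snd c ` fst c"
    by (simp add: eventually_nhds_conv_at)
  then have ev: "\<forall>\<^sub>F y in at (snd c x). y = (snd c \<circ> chart_inv c) y"
    by eventually_elim (auto simp: chart_inv_eq[OF inj])
  have "(snd c \<circ> chart_inv c has_derivative (\<lambda>w. w)) (at (snd c x))"
    using has_derivative_ident ev
    by (rule has_derivative_transform_eventually) (simp_all add: chart_inv_eq[OF inj c(2)])
  then show ?thesis
    by (metis frechet_derivative_at)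
qed

section \<open>Tangent spaces as vector spaces with coordinates\<close>

lemma tangent_spaceI:
  assumes "\<And>c. \<not> (c \<in> A \<and> x \<in> fst c) \<Longrightarrow> v c = 0"
    and "\<And>c d. c \<in> A \<Longrightarrow> d \<in> A \<Longrightarrow> x \<in> fst c \<Longrightarrow> x \<in> fst d \<Longrightarrow>
      v d = frechet_derivative (snd d \<circ> chart_inv c) (at (snd c x)) (v c)"
  shows "v \<in> tangent_space A x"
  unfolding tangent_space_def using assms by blast

lemma tangent_spaceD:
  assumes "v \<in> tangent_space A x"
  shows "\<not> (c \<in> A \<and> x \<in> fst c) \<Longrightarrow> v c = 0"
    and "c \<in> A \<Longrightarrow> d \<in> A \<Longrightarrow> x \<in> fst c \<Longrightarrow> x \<in> fst d \<Longrightarrow>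
      v d = frechet_derivative (snd d \<circ> chart_inv c) (at (snd c x)) (v c)"
  using assms unfolding tangent_space_def by blast+

lemma subspace_tangent_space:
  assumes "differentiable_atlas_at A x"
  shows "subspace (tangent_space A x)"
proof (rule subspaceI)
  note lin = linear_frechet_derivative_transition[OF assms]
  show "0 \<in> tangent_space A x"
    by (rule tangent_spaceI) (simp_all add: linear_0[OF lin])
  show "u + v \<in> tangent_space A x" if "u \<in> tangent_space A x" "v \<in> tangent_space A x" for u v
  proof (rule tangent_spaceI)
    fix c d assume cd: "c \<in> A" "d \<in> A" "x \<in> fst c" "x \<in> fst d"
    show "(u + v) d = frechet_derivative (snd d \<circ> chart_inv c) (at (snd c x)) ((u + v) c)"
      unfolding plus_fun_apply linear_add[OF lin[OF cd]]
      by (simp only: that[THEN tangent_spaceD(2)[OF _ cd], symmetric])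
  qed (simp add: that[THEN tangent_spaceD(1)])
  show "r *\<^sub>R v \<in> tangent_space A x" if "v \<in> tangent_space A x" for r v
  proof (rule tangent_spaceI)
    fix c d assume cd: "c \<in> A" "d \<in> A" "x \<in> fst c" "x \<in> fst d"
    show "(r *\<^sub>R v) d = frechet_derivative (snd d \<circ> chart_inv c) (at (snd c x)) ((r *\<^sub>R v) c)"
      unfolding scaleR_fun_def linear_cmul[OF lin[OF cd]]
      by (simp only: that[THEN tangent_spaceD(2)[OF _ cd], symmetric])
  qed (simp add: scaleR_fun_def that[THEN tangent_spaceD(1)])
qed

lemma tangent_space_eqI:
  assumes "u \<in> tangent_space A x" "v \<in> tangent_space A x" and "c \<in> A" "x \<in> fst c" and "u c = v c"
  shows "u = v"
proof
  fix d
  show "u d = v d"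
  proof (cases "d \<in> A \<and> x \<in> fst d")
    case True
    then show ?thesis
      using tangent_spaceD(2)[OF assms(1), of c d] tangent_spaceD(2)[OF assms(2), of c d] assms(3-5)
      by metis
  next
    case False
    then show ?thesis
      using tangent_spaceD(1)[OF assms(1)] tangent_spaceD(1)[OF assms(2)] by metis
  qed
qed

text \<open>Transporting \<open>w\<close> from \<open>c\<close> to every other chart by the
  derivative of the transition gives a compatible family, by the cocycle identity. Together with
  \<open>tangent_space_eqI\<close>, reading off coordinates in one chart is a bijection onto the
  model space.\<close>

lemma tangent_space_coordinate_surj:
  assumes "differentiable_atlas_at A x" and "c \<in> A" "x \<in> fst c"
  obtains v where "v \<in> tangent_space A x" "v c = w"
proof
  let ?v = "\<lambda>d. if d \<in> A \<and> x \<in> fst d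
    then frechet_derivative (snd d \<circ> chart_inv c) (at (snd c x)) w else 0"
  show "?v \<in> tangent_space A x"
    using assms by (intro tangent_spaceI) (auto simp: frechet_derivative_transition_cocycle)
  show "?v c = w"
    using assms by (simp add: frechet_derivative_transition_self)
qed

section \<open>Push-forwards\<close>

lemma chart_at:
  assumes "x \<in> carrier_of A"
  shows "chart_at A x \<in> A" "x \<in> fst (chart_at A x)"
proof -
  have "\<exists>c. c \<in> A \<and> x \<in> fst c"
    using assms by (auto simp: carrier_of_def)
  from someI_ex[OF this] show "chart_at A x \<in> A" "x \<in> fst (chart_at A x)"
    by (simp_all add: chart_at_def)
qed

lemma linear_push:
  assumes "differentiable_map_at A B f x" and "x \<in> carrier_of A"
  shows "linear (push A B f x)"
proof -
  have lin: "linear (frechet_derivative (snd d \<circ> f \<circ> chart_inv (chart_at A x))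
      (at (snd (chart_at A x) x)))" if "d \<in> B" "f x \<in> fst d" for d
    using assms(1) chart_at[OF assms(2)] that unfolding differentiable_map_at_def
    by (intro linear_frechet_derivative) blast
  show ?thesis
    by (intro linearI ext)
      (auto simp: push_def Let_def scaleR_fun_def linear_add[OF lin] linear_cmul[OF lin])
qed

text \<open>The source chart is fixed in the definition of \<open>push\<close>, so only
  compatibility between charts of the target is at stake, and that is the chain rule of
  \<open>frechet_derivative_chart_change\<close>.\<close>

lemma push_in_tangent_space:
  assumes A: "differentiable_atlas_at A x" and B: "differentiable_atlas_at B (f x)"
    and f: "differentiable_map_at A B f x" and x: "x \<in> carrier_of A"
  shows "push A B f x v \<in> tangent_space B (f x)"
proof -
  let ?c = "chart_at A x"
  note c = chart_at[OF x]
  have inj: "inj_on (snd ?c) (fst ?c)"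
    using A c unfolding differentiable_atlas_at_def by blast
  show ?thesis
  proof (rule tangent_spaceI)
    fix d e assume d: "d \<in> B" and e: "e \<in> B" and fd: "f x \<in> fst d" and fe: "f x \<in> fst e"
    show "push A B f x v e =
        frechet_derivative (snd e \<circ> chart_inv d) (at (snd d (f x))) (push A B f x v d)"
      using frechet_derivative_chart_change[of B f x d e ?c "v ?c", OF B d e fd fe
          chart_inv_eq[OF inj c(2)] differentiable_map_atD[OF f c(1) d c(2) fd]] d e fd fe
      unfolding push_def Let_def by presburger
  qed (auto simp: push_def)
qed


section \<open>Totally real submanifolds and their normal bundles\<close>

text \<open>Names the members of \<open>normal_atlas\<close> by their base chart, base set and
  frame.\<close>

definition bundle_chart ::
  "('m, 'e::euclidean_space) chart set \<Rightarrow> ('m, 'f::euclidean_space) chart set \<Rightarrow>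
   ('m \<Rightarrow> ('m, 'e) tvec \<Rightarrow> ('m, 'e) tvec \<Rightarrow> real) \<Rightarrow> ('m, 'f) chart \<Rightarrow> 'm set \<Rightarrow>
   ('m \<Rightarrow> 'f \<Rightarrow> ('m, 'e) tvec) \<Rightarrow> ('m \<times> ('m, 'e) tvec, 'f \<times> 'f) chart"
  where "bundle_chart A B g c W E =
    ({(x, \<theta>). x \<in> W \<and> \<theta> \<in> normal_fibre A B g x}, \<lambda>(x, \<theta>). (snd c x, inv (E x) \<theta>))"

lemma bundle_chart_simps [simp]:
  "(x, \<theta>) \<in> fst (bundle_chart A B g c W E) \<longleftrightarrow> x \<in> W \<and> \<theta> \<in> normal_fibre A B g x"
  "snd (bundle_chart A B g c W E) (x, \<theta>) = (snd c x, inv (E x) \<theta>)"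
  by (simp_all add: bundle_chart_def)

lemma normal_atlasE:
  assumes "C \<in> normal_atlas A B g"
  obtains c W E where "C = bundle_chart A B g c W E" "c \<in> B" "W \<subseteq> fst c"
    "openin (atlas_topology B) W" "normal_frame A B g W E"
  using assms unfolding normal_atlas_def bundle_chart_def by blast

locale totally_real_submanifold =
  fixes A :: "('m, 'e::euclidean_space) chart set"
    and B :: "('m, 'f::euclidean_space) chart set"
    and g :: "'m \<Rightarrow> ('m, 'e) tvec \<Rightarrow> ('m, 'e) tvec \<Rightarrow> real"
    and J :: "'m \<Rightarrow> ('m, 'e) tvec \<Rightarrow> ('m, 'e) tvec"
  assumes smooth_manifold_ambient: "smooth_manifold A"
    and riemannian_metric: "riemannian_metric A g"
    and almost_complex: "almost_complex_structure A J"
    and J_isometry: "\<forall>x\<in>carrier_of A. \<forall>u\<in>tangent_space A x. \<forall>v\<in>tangent_space A x.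
           g x (J x u) (J x v) = g x u v"
    and submanifold: "submanifold A B"
    and totally_real: "totally_real A B g J"
begin

abbreviation "tangent \<equiv> sub_tangent_space A B"
abbreviation "normal \<equiv> normal_fibre A B g"
abbreviation "bundle_atlas \<equiv> normal_atlas A B g"

lemma smooth_manifold_sub: "smooth_manifold B"
  and carrier_subset: "x \<in> carrier_of B \<Longrightarrow> x \<in> carrier_of A"
  using submanifold by (auto simp: submanifold_def)

lemmas ambient_atlas = smooth_manifold_differentiable_atlas_at[OF smooth_manifold_ambient]
lemmas sub_atlas = smooth_manifold_differentiable_atlas_at[OF smooth_manifold_sub]

section \<open>Linear algebra of the metric and of \<open>J\<close> along the submanifold\<close>

lemma metric:
  assumes "x \<in> carrier_of A"
  shows metric_add: "\<And>u v w. u \<in> tangent_space A x \<Longrightarrow> v \<in> tangent_space A x \<Longrightarrow>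
      w \<in> tangent_space A x \<Longrightarrow> g x u (v + w) = g x u v + g x u w"
    and metric_scaleR: "\<And>u v r. u \<in> tangent_space A x \<Longrightarrow> v \<in> tangent_space A x \<Longrightarrow>
      g x u (r *\<^sub>R v) = r * g x u v"
    and metric_commute: "\<And>u v. u \<in> tangent_space A x \<Longrightarrow> v \<in> tangent_space A x \<Longrightarrow>
      g x u v = g x v u"
    and metric_pos: "\<And>v. v \<in> tangent_space A x \<Longrightarrow> v \<noteq> 0 \<Longrightarrow> 0 < g x v v"
  using riemannian_metric assms
  unfolding riemannian_metric_def inner_product_on_def linear_on_space_def by auto

lemma J:
  assumes "x \<in> carrier_of A"
  shows J_in: "\<And>u. u \<in> tangent_space A x \<Longrightarrow> J x u \<in> tangent_space A x"
    and J_add: "\<And>u v. u \<in> tangent_space A x \<Longrightarrow> v \<in> tangent_space A x \<Longrightarrow>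
      J x (u + v) = J x u + J x v"
    and J_scaleR: "\<And>u r. u \<in> tangent_space A x \<Longrightarrow> J x (r *\<^sub>R u) = r *\<^sub>R J x u"
    and J_J: "\<And>u. u \<in> tangent_space A x \<Longrightarrow> J x (J x u) = - u"
  using almost_complex assms
  unfolding almost_complex_structure_def linear_endomorphism_def linear_on_space_def by blast+

lemma inclusion_differentiable:
  assumes "x \<in> carrier_of B"
  shows "differentiable_map_at B A (\<lambda>y. y) x"
  using smooth_map_on_differentiable_map_at[OF smooth_manifold_sub _ assms] submanifold
  unfolding submanifold_def by blast

lemma linear_incl: "x \<in> carrier_of B \<Longrightarrow> linear (incl A B x)"
  unfolding incl_def by (rule linear_push[OF inclusion_differentiable])

lemma incl_in: "x \<in> carrier_of B \<Longrightarrow> incl A B x v \<in> tangent_space A x"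
  unfolding incl_def
  using push_in_tangent_space[OF sub_atlas ambient_atlas inclusion_differentiable] by blast

lemma inj_on_incl: "x \<in> carrier_of B \<Longrightarrow> inj_on (incl A B x) (tangent_space B x)"
  using submanifold by (simp add: submanifold_def)

lemma subspace_tangent: "x \<in> carrier_of B \<Longrightarrow> subspace (tangent x)"
  unfolding sub_tangent_space_def
  by (intro linear_subspace_image linear_incl subspace_tangent_space sub_atlas)

lemma tangent_ambient: "x \<in> carrier_of B \<Longrightarrow> u \<in> tangent x \<Longrightarrow> u \<in> tangent_space A x"
  unfolding sub_tangent_space_def using incl_in by blast

lemma normal_ambient: "n \<in> normal x \<Longrightarrow> n \<in> tangent_space A x"
  by (simp add: normal_fibre_def)

lemma subspace_normal:
  assumes x: "x \<in> carrier_of B"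
  shows "subspace (normal x)"
proof -
  note T = subspace_tangent_space[OF ambient_atlas]
  note xA = carrier_subset[OF x]
  \<comment> \<open>The metric axioms give linearity in the second argument, so orthogonality is
    rewritten with the variable vector in that place.\<close>
  have iff: "n \<in> normal x \<longleftrightarrow> n \<in> tangent_space A x \<and> (\<forall>v\<in>tangent x. g x v n = 0)" for n
    unfolding normal_fibre_def using metric_commute[OF xA] tangent_ambient[OF x] by auto
  show ?thesis
  proof (rule subspaceI)
    have "g x v 0 = 0" if "v \<in> tangent_space A x" for v
      using metric_scaleR[OF xA that that, of 0] by simp
    then show "0 \<in> normal x"
      using subspace_0[OF T] tangent_ambient[OF x] by (auto simp: iff)
  qed (use subspace_add[OF T] subspace_scale[OF T] metric_add[OF xA] metric_scaleR[OF xA]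
      tangent_ambient[OF x] in \<open>auto simp: iff\<close>)
qed

lemma J_tangent:
  assumes x: "x \<in> carrier_of B" and u: "u \<in> tangent x"
  shows "J x u \<in> normal x"
proof -
  note xA = carrier_subset[OF x]
  have "g x v (J x u) = 0" if "v \<in> tangent x" for v
    using totally_real x u that unfolding totally_real_def by blast
  then show ?thesis
    unfolding normal_fibre_def
    using metric_commute[OF xA] J_in[OF xA] tangent_ambient[OF x] u by auto
qed

text \<open>Write \<open>n = u + J x v\<close> with \<open>u\<close> and \<open>v\<close> tangent.
  Pairing with \<open>u\<close> kills both \<open>n\<close> and \<open>J x v\<close>, so
  \<open>u\<close> has length zero and \<open>n = J x v\<close>, whose image under
  \<open>J x\<close> is \<open>- v\<close>.\<close>

lemma J_normal:
  assumes x: "x \<in> carrier_of B" and n: "n \<in> normal x"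
  shows "J x n \<in> tangent x"
proof -
  note xA = carrier_subset[OF x]
  obtain u v where u: "u \<in> tangent x" and v: "v \<in> tangent x" and nuv: "n = u + J x v"
    using totally_real x normal_ambient[OF n] unfolding totally_real_def by blast
  have "g x u n = 0" "g x u (J x v) = 0"
    using n u J_tangent[OF x v] metric_commute[OF xA] tangent_ambient[OF x u]
    unfolding normal_fibre_def by auto
  then have "g x u u = 0"
    unfolding nuv
    using metric_add[OF xA] u v tangent_ambient[OF x] J_in[OF xA] by simp
  then have "u = 0"
    using metric_pos[OF xA] tangent_ambient[OF x u] by force
  then have "J x n = - v"
    unfolding nuv using J_J[OF xA tangent_ambient[OF x v]] by simp
  then show ?thesis
    using subspace_neg[OF subspace_tangent[OF x] v] by simp
qed

text \<open>The model space has a nonempty basis, and the derivative of the inclusion is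
  injective.\<close>

lemma tangent_nontrivial:
  assumes x: "x \<in> carrier_of B"
  obtains u where "u \<in> tangent x" "u \<noteq> 0"
proof -
  obtain c where c: "c \<in> B" "x \<in> fst c"
    using x by (auto simp: carrier_of_def)
  obtain b :: 'f where b: "b \<in> Basis"
    using nonempty_Basis by blast
  obtain v where v: "v \<in> tangent_space B x" "v c = b"
    by (rule tangent_space_coordinate_surj[OF sub_atlas c])
  have "v \<noteq> 0"
    using v(2) b by auto
  then have "incl A B x v \<noteq> 0"
    using inj_onD[OF inj_on_incl[OF x], of v 0] v(1) linear_0[OF linear_incl[OF x]]
      subspace_0[OF subspace_tangent_space[OF sub_atlas]] by force
  then show ?thesis
    using that v(1) unfolding sub_tangent_space_def by blast
qed

text \<open>\<open>J x\<close> squares to minus the identity, so it carries a nonzero tangent vector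
  to a nonzero normal one. The existence of such a vector later shows that the bundle charts cover
  the point.\<close>

lemma normal_nontrivial:
  assumes x: "x \<in> carrier_of B"
  obtains n where "n \<in> normal x" "n \<noteq> 0"
proof -
  obtain u where u: "u \<in> tangent x" "u \<noteq> 0"
    by (rule tangent_nontrivial[OF x])
  have "J x 0 = 0"
    using J_scaleR[OF carrier_subset[OF x] tangent_ambient[OF x u(1)], of 0] by simp
  then have "J x u \<noteq> 0"
    using J_J[OF carrier_subset[OF x] tangent_ambient[OF x u(1)]] u(2) by auto
  then show ?thesis
    using that J_tangent[OF x u(1)] by blast
qed

section \<open>Frames of the normal bundle and differentiability of its transition maps\<close>

lemma frame:
  assumes "normal_frame A B g W E" and "x \<in> W"
  shows frame_linear: "linear (E x)"
    and frame_in: "E x f \<in> normal x"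
    and frame_inv_left: "inv (E x) (E x f) = f"
    and frame_inv_right: "n \<in> normal x \<Longrightarrow> E x (inv (E x) n) = n"
proof -
  have E: "linear (E x)" "bij_betw (E x) UNIV (normal x)"
    using assms by (auto simp: normal_frame_def)
  show "linear (E x)" "E x f \<in> normal x" "inv (E x) (E x f) = f"
    using E by (auto simp: bij_betw_def)
  show "E x (inv (E x) n) = n" if "n \<in> normal x"
    using E(2) that by (simp add: bij_betw_def f_inv_into_f)
qed

lemma frame_inv_add_scaleR:
  assumes E: "normal_frame A B g W E" and x: "x \<in> W" and n: "m \<in> normal x" "n \<in> normal x"
  shows "inv (E x) (m + t *\<^sub>R n) = inv (E x) m + t *\<^sub>R inv (E x) n"
proof -
  have "m + t *\<^sub>R n = E x (inv (E x) m + t *\<^sub>R inv (E x) n)"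
    using frame_inv_right[OF E x] n
    by (simp add: linear_add[OF frame_linear[OF E x]] linear_cmul[OF frame_linear[OF E x]])
  then show ?thesis
    using frame_inv_left[OF E x] by metis
qed

text \<open>The second component of the tangent bundle chart over \<open>a\<close> reads off
  coordinates in \<open>a\<close>, so smoothness of the frame as a map into the tangent bundle
  passes to its coordinates.\<close>

lemma frame_coordinate_differentiable:
  assumes E: "normal_frame A B g W E" and c: "c \<in> B" "x \<in> fst c" and x: "x \<in> W"
    and a: "a \<in> A" "x \<in> fst a"
  shows "(\<lambda>y. E (chart_inv c y) b a) differentiable (at (snd c x))"
proof -
  let ?a = "({(x, v). x \<in> fst a \<and> v \<in> tangent_space A x}, \<lambda>(x, v). (snd a x, v a))"
  have "differentiable_map_at B (tangent_atlas A) (\<lambda>y. (y, E y b)) x"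
    using E x unfolding normal_frame_def
    by (intro smooth_map_on_differentiable_map_at[OF smooth_manifold_sub]) auto
  moreover have "?a \<in> tangent_atlas A"
    using a(1) by (auto simp: tangent_atlas_def)
  moreover have "(x, E x b) \<in> fst ?a"
    using a(2) normal_ambient[OF frame_in[OF E x]] by simp
  ultimately have "(snd ?a \<circ> (\<lambda>y. (y, E y b)) \<circ> chart_inv c) differentiable (at (snd c x))"
    using c unfolding differentiable_map_at_def by blast
  then have "(snd \<circ> (snd ?a \<circ> (\<lambda>y. (y, E y b)) \<circ> chart_inv c)) differentiable (at (snd c x))"
    by (rule differentiable_chain_at)
      (simp add: bounded_linear_imp_differentiable bounded_linear_snd)
  then show ?thesis
    by (simp add: o_def)
qed

lemma sub_chart_inv: "c \<in> B \<Longrightarrow> y \<in> fst c \<Longrightarrow> chart_inv c (snd c y) = y"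
  using smooth_manifold_sub by (auto simp: smooth_manifold_def chart_inv_eq)

lemma inj_on_bundle_chart:
  assumes "c \<in> B" "W \<subseteq> fst c" and E: "normal_frame A B g W E"
  shows "inj_on (snd (bundle_chart A B g c W E)) (fst (bundle_chart A B g c W E))"
proof (rule inj_onI)
  fix z z' assume z: "z \<in> fst (bundle_chart A B g c W E)" "z' \<in> fst (bundle_chart A B g c W E)"
    "snd (bundle_chart A B g c W E) z = snd (bundle_chart A B g c W E) z'"
  obtain x \<theta> x' \<theta>' where zz: "z = (x, \<theta>)" "z' = (x', \<theta>')"
    by fastforce
  have "x = x'"
    using z sub_chart_inv[OF assms(1)] assms(2) unfolding zz bundle_chart_simps
    by (metis Pair_inject subsetD)
  moreover have "\<theta> = \<theta>'"
    using z \<open>x = x'\<close> frame_inv_right[OF E] unfolding zz bundle_chart_simps by (metis Pair_inject)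
  ultimately show "z = z'"
    by (simp add: zz)
qed

lemma bundle_chart_inv:
  assumes c: "c \<in> B" "W \<subseteq> fst c" and E: "normal_frame A B g W E" and x: "x \<in> W"
  shows "chart_inv (bundle_chart A B g c W E) (snd c x, f) = (x, E x f)"
proof -
  have "(x, E x f) \<in> fst (bundle_chart A B g c W E)"
    using x frame_in[OF E x] by simp
  from chart_inv_eq[OF inj_on_bundle_chart[OF c E] this] show ?thesis
    by (simp add: frame_inv_left[OF E x])
qed

text \<open>Fibre coordinates range over the whole model space, so the image of a bundle chart is a
  product with \<open>UNIV\<close> and only the base coordinate is constrained.\<close>

lemma eventually_base:
  assumes c: "c \<in> B" "W \<subseteq> fst c" and W: "openin (atlas_topology B) W" and x: "x \<in> W"
  shows "\<forall>\<^sub>F w in nhds (snd c x, f :: 'f). fst w \<in> snd c ` W"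
proof -
  have "open (snd c ` (W \<inter> fst c))"
    using W c(1) by (simp add: openin_atlas_topology[OF smooth_manifold_sub])
  then have "open ((snd c ` W) \<times> (UNIV :: 'f set))"
    using c(2) by (simp add: Int_absorb2 open_Times)
  from eventually_nhds_in_open[OF this, of "(snd c x, f)"] show ?thesis
    using x by (simp add: mem_Times_iff)
qed

text \<open>The new coefficients \<open>h\<close> solve \<open>E' y h = E y f\<close>. Reading both
  sides in one ambient chart \<open>a\<close> gives a linear equation with differentiable data,
  injective at \<open>x\<close>, to which \<open>differentiable_linear_equation_solution\<close>
  applies.\<close>

lemma frame_change_differentiable:
  assumes c: "c \<in> B" "V \<subseteq> fst c" and V: "openin (atlas_topology B) V" and x: "x \<in> V"
    and E: "normal_frame A B g W E" "V \<subseteq> W" and E': "normal_frame A B g W' E'" "V \<subseteq> W'"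
  shows "(\<lambda>w. inv (E' (chart_inv c (fst w))) (E (chart_inv c (fst w)) (snd w)))
    differentiable (at (snd c x, f))"
proof -
  have EV: "y \<in> W" "y \<in> W'" if "y \<in> V" for y
    using that E(2) E'(2) by auto
  have xB: "x \<in> fst c" "x \<in> carrier_of B"
    using x c by (auto simp: carrier_of_def)
  obtain a where a: "a \<in> A" "x \<in> fst a"
    using carrier_subset[OF xB(2)] by (auto simp: carrier_of_def)
  note ev = eventually_base[OF c V x, of f]
  note ci = sub_chart_inv[OF c(1)]
  have base: "chart_inv c (fst w) \<in> V" if "fst w \<in> snd c ` V" for w :: "'f \<times> 'f"
    using that ci c(2) by auto
  have coord: "(\<lambda>w. F (chart_inv c (fst w)) b a) differentiable (at (snd c x, f))"
    if "normal_frame A B g U F" "V \<subseteq> U" for U F b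
  proof -
    have "((\<lambda>y. F (chart_inv c y) b a) \<circ> fst) differentiable (at (snd c x, f))"
      by (rule differentiable_chain_at[OF bounded_linear_imp_differentiable[OF bounded_linear_fst]])
        (simp add: frame_coordinate_differentiable[OF that(1) c(1) xB(1) subsetD[OF that(2) x] a])
    then show ?thesis
      by (simp add: o_def)
  qed
  have lin: "linear (\<lambda>h. F y h a)" if "normal_frame A B g U F" "y \<in> U" for U F y
    using frame_linear[OF that]
    by (intro linearI) (simp_all add: linear_add linear_cmul plus_fun_def scaleR_fun_def)
  show ?thesis
  proof (rule differentiable_linear_equation_solution)
    show "\<forall>\<^sub>F w in nhds (snd c x, f). linear (\<lambda>h. E' (chart_inv c (fst w)) h a)"
      using ev by eventually_elim (rule lin[OF E'(1) EV(2)[OF base]])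
    \<comment> \<open>Injectivity is claimed over \<open>x\<close> itself, where \<open>a\<close> is
      a chart and its coordinate vector determines the tangent vector.\<close>
    show "inj (\<lambda>h. E' (chart_inv c (fst (snd c x, f))) h a)"
    proof (rule injI)
      fix h k assume "E' (chart_inv c (fst (snd c x, f))) h a = E' (chart_inv c (fst (snd c x, f))) k a"
      then have "E' x h a = E' x k a"
        by (simp add: ci xB(1))
      then have "E' x h = E' x k"
        by (rule tangent_space_eqI[OF _ _ a, rotated -1])
          (rule normal_ambient[OF frame_in[OF E'(1) EV(2)[OF x]]])+
      then show "h = k"
        using frame_inv_left[OF E'(1) EV(2)[OF x]] by metis
    qed
    show "(\<lambda>w. E' (chart_inv c (fst w)) b a) differentiable (at (snd c x, f))" for b
      by (rule coord[OF E'])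
    \<comment> \<open>Frame and coefficients both vary with \<open>w\<close>; by linearity the value
      is a finite sum of products of differentiable maps.\<close>
    have "(\<lambda>w. \<Sum>b\<in>Basis. (snd w \<bullet> b) *\<^sub>R E (chart_inv c (fst w)) b a)
        differentiable (at (snd c x, f))"
      by (intro differentiable_sum differentiable_scaleR coord[OF E] ballI finite_Basis
          bounded_linear_imp_differentiable bounded_linear_inner_left_comp bounded_linear_snd)
    then show "(\<lambda>w. E (chart_inv c (fst w)) (snd w) a) differentiable (at (snd c x, f))"
    proof (rule differentiable_transform_eventually)
      show "\<forall>\<^sub>F w in nhds (snd c x, f). (\<Sum>b\<in>Basis. (snd w \<bullet> b) *\<^sub>R E (chart_inv c (fst w)) b a) =
          E (chart_inv c (fst w)) (snd w) a"
        using ev by eventually_elim (rule linear_sum_Basis[OF lin[OF E(1) EV(1)[OF base]], symmetric])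
    qed
    show "\<forall>\<^sub>F w in nhds (snd c x, f). E' (chart_inv c (fst w))
        (inv (E' (chart_inv c (fst w))) (E (chart_inv c (fst w)) (snd w))) a =
        E (chart_inv c (fst w)) (snd w) a"
      using ev by eventually_elim
        (simp add: frame_inv_right[OF E'(1) EV(2)[OF base]] frame_in[OF E(1) EV(1)[OF base]])
  qed
qed

text \<open>In bundle charts a transition map is the transition of the base charts paired with the
  change of frame.\<close>

lemma differentiable_atlas_at_bundle: "differentiable_atlas_at bundle_atlas z"
  unfolding differentiable_atlas_at_def
proof (intro conjI ballI impI)
  fix C assume "C \<in> bundle_atlas"
  then show "inj_on (snd C) (fst C)"
    by (auto elim!: normal_atlasE intro!: inj_on_bundle_chart)
next
  fix C C' assume C: "C \<in> bundle_atlas" "z \<in> fst C" and C': "C' \<in> bundle_atlas" "z \<in> fst C'"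
  obtain x \<theta> where z: "z = (x, \<theta>)"
    by fastforce
  obtain c W E where CE: "C = bundle_chart A B g c W E" and c: "c \<in> B" "W \<subseteq> fst c"
    and W: "openin (atlas_topology B) W" and E: "normal_frame A B g W E"
    by (rule normal_atlasE[OF C(1)])
  obtain d W' E' where CE': "C' = bundle_chart A B g d W' E'" and d: "d \<in> B" "W' \<subseteq> fst d"
    and W': "openin (atlas_topology B) W'" and E': "normal_frame A B g W' E'"
    by (rule normal_atlasE[OF C'(1)])
  have x: "x \<in> W" "x \<in> W'" "x \<in> fst c" "x \<in> fst d" "x \<in> W \<inter> W'"
    using C C' c d by (auto simp: z CE CE')
  have Vc: "W \<inter> W' \<subseteq> fst c"
    using c(2) by blast
  have V: "openin (atlas_topology B) (W \<inter> W')"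
    using W W' by (rule openin_Int)
  let ?f = "inv (E x) \<theta>"
  have zc: "snd C z = (snd c x, ?f)"
    by (simp add: z CE)
  have ev: "\<forall>\<^sub>F w in nhds (snd c x, ?f). fst w \<in> snd c ` (W \<inter> W')"
    by (rule eventually_base[OF c(1) Vc V x(5)])
  \<comment> \<open>Over the common base set \<open>chart_inv C\<close> is a true inverse, given by
    the frame, and not an arbitrary value of \<open>inv_into\<close>.\<close>
  have inverse: "chart_inv C w = (chart_inv c (fst w), E (chart_inv c (fst w)) (snd w))"
    "snd C (chart_inv C w) = w" "chart_inv C w \<in> fst C" "chart_inv C w \<in> fst C'"
    if w: "fst w \<in> snd c ` (W \<inter> W')" for w
  proof -
    obtain y where y: "y \<in> W" "y \<in> W'" "fst w = snd c y"
      using w by blast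
    have ci: "chart_inv c (fst w) = y"
      using sub_chart_inv[OF c(1)] c(2) y by auto
    show 1: "chart_inv C w = (chart_inv c (fst w), E (chart_inv c (fst w)) (snd w))"
      unfolding ci using bundle_chart_inv[OF c E y(1), of "snd w"] by (simp add: CE flip: y(3))
    show "snd C (chart_inv C w) = w" "chart_inv C w \<in> fst C" "chart_inv C w \<in> fst C'"
      unfolding 1 ci using y frame_in[OF E y(1)] frame_inv_left[OF E y(1)]
      by (auto simp: CE CE' prod_eq_iff)
  qed
  show "\<forall>\<^sub>F w in nhds (snd C z). w \<in> snd C ` (fst C \<inter> fst C')"
    unfolding zc using ev by eventually_elim (use inverse(2-4) in \<open>metis IntI imageI\<close>)
  have "(\<lambda>w. ((snd d \<circ> chart_inv c) (fst w),
      inv (E' (chart_inv c (fst w))) (E (chart_inv c (fst w)) (snd w))))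
    differentiable (at (snd c x, ?f))"
  proof (rule differentiable_Pair)
    have "(snd d \<circ> chart_inv c) differentiable (at (snd c x))"
      using sub_atlas[of x] c(1) d(1) x by (simp add: differentiable_atlas_at_def)
    then have "((snd d \<circ> chart_inv c) \<circ> fst) differentiable (at (snd c x, ?f))"
      by (intro differentiable_chain_at[OF bounded_linear_imp_differentiable[OF bounded_linear_fst]])
        simp
    then show "(\<lambda>w. (snd d \<circ> chart_inv c) (fst w)) differentiable (at (snd c x, ?f))"
      by (simp add: o_def)
  qed (rule frame_change_differentiable[OF c(1) Vc V x(5) E _ E'], auto)
  then have "(snd C' \<circ> chart_inv C) differentiable (at (snd c x, ?f))"
    by (rule differentiable_transform_eventually)
      (use ev in eventually_elim, simp add: inverse(1), simp add: CE')
  then show "(snd C' \<circ> chart_inv C) differentiable (at (snd C z))"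
    by (simp add: zc)
qed

section \<open>The bundle projection and its derivative\<close>

lemma projection_in_bundle_chart:
  assumes c: "c \<in> B" "W \<subseteq> fst c" and W: "openin (atlas_topology B) W"
    and E: "normal_frame A B g W E" and x: "x \<in> W"
  shows "\<forall>\<^sub>F w in nhds (snd c x, f). fst w \<in> snd c ` W \<and>
    fst (chart_inv (bundle_chart A B g c W E) w) = chart_inv c (fst w)"
  using eventually_base[OF c W x, of f]
proof eventually_elim
  case (elim w)
  then obtain y where y: "y \<in> W" "fst w = snd c y"
    by blast
  have "chart_inv (bundle_chart A B g c W E) w = (y, E y (snd w))"
    using bundle_chart_inv[OF c E y(1), of "snd w"] by (simp flip: y(2))
  then show ?case
    using elim sub_chart_inv[OF c(1)] c(2) y by auto
qed

lemma projection_differentiable: "differentiable_map_at bundle_atlas B fst z"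
  unfolding differentiable_map_at_def
proof (intro ballI impI conjI)
  fix C d assume C: "C \<in> bundle_atlas" "z \<in> fst C" and d: "d \<in> B" "fst z \<in> fst d"
  obtain x \<theta> where z: "z = (x, \<theta>)"
    by fastforce
  obtain c W E where CE: "C = bundle_chart A B g c W E" and c: "c \<in> B" "W \<subseteq> fst c"
    and W: "openin (atlas_topology B) W" and E: "normal_frame A B g W E"
    by (rule normal_atlasE[OF C(1)])
  have x: "x \<in> W" "x \<in> fst c" "x \<in> fst d"
    using C d c by (auto simp: z CE)
  have zc: "snd C z = (snd c x, inv (E x) \<theta>)"
    by (simp add: z CE)
  note ev = projection_in_bundle_chart[OF c W E x(1), of "inv (E x) \<theta>", folded CE zc]
  have tr: "\<forall>\<^sub>F y in nhds (snd c x). y \<in> snd c ` (fst c \<inter> fst d)"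
    "(snd d \<circ> chart_inv c) differentiable (at (snd c x))"
    using sub_atlas[of x] c(1) d(1) x by (simp_all add: differentiable_atlas_at_def)
  have "filterlim fst (nhds (snd c x)) (nhds (snd C z))"
    unfolding zc using tendsto_fst[OF filterlim_ident, of "(snd c x, inv (E x) \<theta>)"] by simp
  from eventually_compose_filterlim[OF tr(1) this]
  show "\<forall>\<^sub>F w in nhds (snd C z). fst (chart_inv C w) \<in> fst d"
    using ev
  proof eventually_elim
    case (elim w)
    then obtain y where "y \<in> fst c" "y \<in> fst d" "fst w = snd c y"
      by blast
    then show ?case
      using elim sub_chart_inv[OF c(1)] by simp
  qed
  have "((snd d \<circ> chart_inv c) \<circ> fst) differentiable (at (snd C z))"
    by (rule differentiable_chain_at[OF bounded_linear_imp_differentiable[OF bounded_linear_fst]])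
      (simp add: zc tr(2))
  then show "(snd d \<circ> fst \<circ> chart_inv C) differentiable (at (snd C z))"
    by (rule differentiable_transform_eventually) (use ev in eventually_elim, simp)
qed

text \<open>Read in the base chart \<open>c\<close> underlying the bundle chart that
  \<open>push\<close> selects, the projection is literally \<open>fst\<close> near the point, hence
  equal to its own derivative there.\<close>

lemma push_projection:
  assumes z: "z \<in> carrier_of bundle_atlas"
    and C: "chart_at bundle_atlas z = bundle_chart A B g c W E"
    and c: "c \<in> B" "W \<subseteq> fst c" and W: "openin (atlas_topology B) W"
    and E: "normal_frame A B g W E"
  shows "push bundle_atlas B fst z a c = fst (a (chart_at bundle_atlas z))"
proof -
  obtain x \<theta> where zx: "z = (x, \<theta>)"
    by fastforce
  have x: "x \<in> W" "x \<in> fst c"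
    using chart_at(2)[OF z] c(2) unfolding C by (auto simp: zx)
  let ?C = "bundle_chart A B g c W E"
  have "\<forall>\<^sub>F w in nhds (snd ?C z). fst w = (snd c \<circ> fst \<circ> chart_inv ?C) w"
    using projection_in_bundle_chart[OF c W E x(1), of "inv (E x) \<theta>"]
    unfolding zx bundle_chart_simps
    by eventually_elim (use c(2) in \<open>auto simp: sub_chart_inv[OF c(1)]\<close>)
  moreover have "(fst has_derivative fst) (at (snd ?C z))"
    by (rule bounded_linear_imp_has_derivative[OF bounded_linear_fst])
  ultimately have D: "(snd c \<circ> fst \<circ> chart_inv ?C has_derivative fst) (at (snd ?C z))"
    using eventually_nhds_x_imp_x
    by (auto elim!: has_derivative_transform_eventually simp: eventually_nhds_conv_at)
  have "fst z \<in> fst c"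
    using x by (simp add: zx)
  then show ?thesis
    using c(1) unfolding push_def C Let_def by (simp flip: frechet_derivative_at[OF D])
qed

section \<open>Velocities of lines in the fibres\<close>

lemma velocity_vertical:
  assumes C: "bundle_chart A B g c W E \<in> bundle_atlas"
    and E: "normal_frame A B g W E" and x: "x \<in> W" and \<theta>: "\<theta> \<in> normal x" and \<xi>: "\<xi> \<in> normal x"
  shows "velocity bundle_atlas (\<lambda>t. (x, \<theta> + t *\<^sub>R \<xi>)) 0 (bundle_chart A B g c W E) =
      (0, inv (E x) \<xi>)" (is ?value)
    and "((snd (bundle_chart A B g c W E) \<circ> (\<lambda>t. (x, \<theta> + t *\<^sub>R \<xi>))) has_vector_derivative
      velocity bundle_atlas (\<lambda>t. (x, \<theta> + t *\<^sub>R \<xi>)) 0 (bundle_chart A B g c W E)) (at 0)"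
proof -
  have "((\<lambda>t. (snd c x, inv (E x) \<theta> + t *\<^sub>R inv (E x) \<xi>)) has_vector_derivative
      (0, inv (E x) \<xi>)) (at 0)"
    unfolding has_vector_derivative_def by (auto intro!: derivative_eq_intros)
  \<comment> \<open>\<open>inv (E x)\<close> is linear on the normal space, so the line stays affine
    in fibre coordinates while the base coordinate is constant.\<close>
  moreover have "snd (bundle_chart A B g c W E) \<circ> (\<lambda>t. (x, \<theta> + t *\<^sub>R \<xi>)) =
      (\<lambda>t. (snd c x, inv (E x) \<theta> + t *\<^sub>R inv (E x) \<xi>))"
    by (simp add: fun_eq_iff frame_inv_add_scaleR[OF E x \<theta> \<xi>])
  ultimately have D: "((snd (bundle_chart A B g c W E) \<circ> (\<lambda>t. (x, \<theta> + t *\<^sub>R \<xi>)))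
      has_vector_derivative (0, inv (E x) \<xi>)) (at 0)"
    by simp
  then show ?value
    using C x \<theta> vector_derivative_at[OF D] by (simp add: velocity_def)
  then show "((snd (bundle_chart A B g c W E) \<circ> (\<lambda>t. (x, \<theta> + t *\<^sub>R \<xi>))) has_vector_derivative
      velocity bundle_atlas (\<lambda>t. (x, \<theta> + t *\<^sub>R \<xi>)) 0 (bundle_chart A B g c W E)) (at 0)"
    using D by simp
qed

text \<open>Compatibility between bundle charts is the chain rule for a transition map applied to
  the curve.\<close>

lemma velocity_vertical_in_tangent_space:
  assumes x: "x \<in> carrier_of B" and \<theta>: "\<theta> \<in> normal x" and \<xi>: "\<xi> \<in> normal x"
  shows "velocity bundle_atlas (\<lambda>t. (x, \<theta> + t *\<^sub>R \<xi>)) 0 \<in> tangent_space bundle_atlas (x, \<theta>)"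
proof (rule tangent_spaceI)
  let ?\<gamma> = "\<lambda>t. (x, \<theta> + t *\<^sub>R \<xi>)"
  fix C assume "\<not> (C \<in> bundle_atlas \<and> (x, \<theta>) \<in> fst C)"
  then show "velocity bundle_atlas ?\<gamma> 0 C = 0"
    by (auto simp: velocity_def)
next
  let ?\<gamma> = "\<lambda>t. (x, \<theta> + t *\<^sub>R \<xi>)"
  have derivative: "((snd C \<circ> ?\<gamma>) has_vector_derivative velocity bundle_atlas ?\<gamma> 0 C) (at 0)"
    and curve: "?\<gamma> t \<in> fst C"
    if C: "C \<in> bundle_atlas" "(x, \<theta>) \<in> fst C" for C t
  proof -
    obtain c W E where CE: "C = bundle_chart A B g c W E" and E: "normal_frame A B g W E"
      by (rule normal_atlasE[OF C(1)])
    have xW: "x \<in> W"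
      using C(2) by (simp add: CE)
    show "((snd C \<circ> ?\<gamma>) has_vector_derivative velocity bundle_atlas ?\<gamma> 0 C) (at 0)"
      using velocity_vertical(2)[OF C(1)[unfolded CE] E xW \<theta> \<xi>] by (simp add: CE)
    \<comment> \<open>The normal space is a subspace, so the line stays in the chart for all
      \<open>t\<close>, and the two coordinate curves compared below agree for every
      \<open>t\<close>.\<close>
    show "?\<gamma> t \<in> fst C"
      using xW subspace_add[OF subspace_normal[OF x] \<theta> subspace_scale[OF subspace_normal[OF x] \<xi>]]
      by (simp add: CE)
  qed
  fix C C' assume C: "C \<in> bundle_atlas" "(x, \<theta>) \<in> fst C" and C': "C' \<in> bundle_atlas" "(x, \<theta>) \<in> fst C'"
  have inj: "inj_on (snd C) (fst C)" and "(snd C' \<circ> chart_inv C) differentiable (at (snd C (x, \<theta>)))"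
    using differentiable_atlas_at_bundle[of "(x, \<theta>)"] C C'
    unfolding differentiable_atlas_at_def by blast+
  from this(2) have "((snd C' \<circ> chart_inv C) has_derivative
      frechet_derivative (snd C' \<circ> chart_inv C) (at (snd C (x, \<theta>)))) (at ((snd C \<circ> ?\<gamma>) 0))"
    by (simp add: frechet_derivative_works)
  then have "((snd C' \<circ> chart_inv C) \<circ> (snd C \<circ> ?\<gamma>) has_vector_derivative
      frechet_derivative (snd C' \<circ> chart_inv C) (at (snd C (x, \<theta>)))
        (velocity bundle_atlas ?\<gamma> 0 C)) (at 0)"
    using vector_derivative_diff_chain_within[of "snd C \<circ> ?\<gamma>" _ 0 UNIV] derivative[OF C]
    by (metis has_derivative_at_withinI)
  moreover have "(snd C' \<circ> chart_inv C) \<circ> (snd C \<circ> ?\<gamma>) = snd C' \<circ> ?\<gamma>"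
    using curve[OF C] by (simp add: fun_eq_iff chart_inv_eq[OF inj])
  ultimately show "velocity bundle_atlas ?\<gamma> 0 C' =
      frechet_derivative (snd C' \<circ> chart_inv C) (at (snd C (x, \<theta>))) (velocity bundle_atlas ?\<gamma> 0 C)"
    using vector_derivative_unique_at[OF derivative[OF C']] by simp
qed

end


section \<open>The splitting of the tangent space at a point of the normal bundle\<close>

text \<open>Here \<open>r\<close> stands for \<rho> and \<open>s\<close> for \<sigma>. Everything
  follows from \<open>c * s = r - 1\<close> and \<open>c' * r = c\<close>; there is no division by
  \<open>s\<close>, so the zero section is covered. The first identity serves the square of the
  almost complex structure, the other two its compatibility with the metric.\<close>

lemma sqrt_coefficients:
  fixes q r s :: real
  assumes r: "0 < r" and qs: "q * s = r\<^sup>2 - 1"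
  defines "c \<equiv> q / (1 + r)" and "c' \<equiv> q / (r\<^sup>2 + r)"
  shows "c - c' - c * c' * s = 0" and "2 * c + c\<^sup>2 * s = q"
    and "q * (1 - c' * s)\<^sup>2 + c'\<^sup>2 * s - 2 * c' = 0"
proof -
  have "r\<^sup>2 + r = r * (1 + r)"
    by (simp add: power2_eq_square algebra_simps)
  then have c: "c * (1 + r) = q" and c': "c' * r = c"
    using r by (simp_all add: c_def c'_def)
  have "(c * s) * (1 + r) = q * s"
    by (simp add: mult_ac flip: c)
  also have "\<dots> = (r - 1) * (1 + r)"
    by (simp add: qs algebra_simps power2_eq_square)
  finally have cs: "c * s = r - 1"
    using r by simp
  have c's: "c' * s * r = r - 1"
    using cs by (simp add: mult_ac flip: c')
  have "c - c' - c * c' * s = c' * (r - 1 - c * s)"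
    by (simp add: algebra_simps flip: c')
  then show "c - c' - c * c' * s = 0"
    by (simp add: cs)
  have "2 * c + c\<^sup>2 * s = c * (2 + c * s)"
    by (simp add: algebra_simps power2_eq_square)
  then show "2 * c + c\<^sup>2 * s = q"
    by (simp add: cs flip: c)
  \<comment> \<open>Multiplying by \<open>r\<^sup>2\<close> brings in the products
    \<open>c' * r\<close> and \<open>c' * s * r\<close>, whose values are known.\<close>
  have "(q * (1 - c' * s)\<^sup>2 + c'\<^sup>2 * s - 2 * c') * r\<^sup>2 =
      q * (r - c' * s * r)\<^sup>2 + (c' * r) * (c' * s * r) - 2 * (c' * r) * r"
    by (simp add: algebra_simps power2_eq_square)
  also have "\<dots> = c * (1 + r) + c * (r - 1) - 2 * c * r"
    unfolding c's c' c[symmetric] by simp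
  also have "\<dots> = 0"
    by (simp add: algebra_simps)
  finally show "q * (1 - c' * s)\<^sup>2 + c'\<^sup>2 * s - 2 * c' = 0"
    using r by simp
qed

text \<open>Fixes one point of the normal bundle: the claims are fibrewise, so the rest is linear
  algebra on a single tangent space.\<close>

locale normal_bundle_point = totally_real_submanifold A B g J
  for A :: "('m, 'e::euclidean_space) chart set"
    and B :: "('m, 'f::euclidean_space) chart set"
    and g :: "'m \<Rightarrow> ('m, 'e) tvec \<Rightarrow> ('m, 'e) tvec \<Rightarrow> real"
    and J :: "'m \<Rightarrow> ('m, 'e) tvec \<Rightarrow> ('m, 'e) tvec" +
  fixes nabla :: "('m, 'e) connection"
    and K :: "'m \<times> ('m, 'e) tvec \<Rightarrow> ('m, 'e, 'f) ntvec \<Rightarrow> ('m, 'e) tvec"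
    and p q :: real and x :: 'm and \<theta> :: "('m, 'e) tvec"
  assumes connection_map: "connection_map A B g nabla K"
    and q: "q \<ge> 0"
    and base: "x \<in> carrier_of B"
    and fibre: "\<theta> \<in> normal x"
begin

abbreviation "T \<equiv> tangent_space bundle_atlas (x, \<theta>)"
abbreviation "\<pi> \<equiv> pi_push A B g (x, \<theta>)"
abbreviation "\<kappa> \<equiv> K (x, \<theta>)"
abbreviation "vertical n \<equiv> velocity bundle_atlas (\<lambda>t. (x, \<theta> + t *\<^sub>R n)) 0"

section \<open>Projection and connection map at the fixed point\<close>

lemmas subspace_T = subspace_tangent_space[OF differentiable_atlas_at_bundle]

lemma \<kappa>:
  shows \<kappa>_in: "a \<in> T \<Longrightarrow> \<kappa> a \<in> normal x"
    and \<kappa>_add: "a \<in> T \<Longrightarrow> b \<in> T \<Longrightarrow> \<kappa> (a + b) = \<kappa> a + \<kappa> b"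
    and \<kappa>_scaleR: "a \<in> T \<Longrightarrow> \<kappa> (r *\<^sub>R a) = r *\<^sub>R \<kappa> a"
    and \<kappa>_vertical: "n \<in> normal x \<Longrightarrow> \<kappa> (vertical n) = n"
proof -
  have "(x, \<theta>) \<in> normal_bundle A B g"
    using base fibre by (simp add: normal_bundle_def)
  then have "\<kappa> ` T \<subseteq> normal x \<and> linear_on_space T \<kappa> \<and> (\<forall>n\<in>normal x. \<kappa> (vertical n) = n)"
    using connection_map unfolding connection_map_def by blast
  then show "a \<in> T \<Longrightarrow> \<kappa> a \<in> normal x" "a \<in> T \<Longrightarrow> b \<in> T \<Longrightarrow> \<kappa> (a + b) = \<kappa> a + \<kappa> b"
    "a \<in> T \<Longrightarrow> \<kappa> (r *\<^sub>R a) = r *\<^sub>R \<kappa> a" "n \<in> normal x \<Longrightarrow> \<kappa> (vertical n) = n"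
    unfolding linear_on_space_def by blast+
qed

text \<open>If no bundle chart contained \<open>(x, \<theta>)\<close>, every velocity there would be the junk value \<open>0\<close>,
  contradicting the normalisation of \<open>K\<close> on vertical vectors. So no local frame of the normal
  bundle has to be constructed.\<close>

lemma in_carrier_bundle: "(x, \<theta>) \<in> carrier_of bundle_atlas"
proof (rule ccontr)
  assume "(x, \<theta>) \<notin> carrier_of bundle_atlas"
  then have "vertical n = 0" for n
    by (auto simp: fun_eq_iff velocity_def carrier_of_def)
  moreover have "\<kappa> 0 = 0"
    using \<kappa>_scaleR[OF subspace_0[OF subspace_T], of 0] by simp
  ultimately have "n = 0" if "n \<in> normal x" for n
    using \<kappa>_vertical[OF that] by simp
  then show False
    using normal_nontrivial[OF base] by blast
qed

lemma push_projection_in: "push bundle_atlas B fst (x, \<theta>) a \<in> tangent_space B x"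
  using push_in_tangent_space[OF differentiable_atlas_at_bundle sub_atlas projection_differentiable
      in_carrier_bundle] by simp

lemma linear_\<pi>: "linear \<pi>"
proof -
  have "\<pi> = incl A B x \<circ> push bundle_atlas B fst (x, \<theta>)"
    by (simp add: fun_eq_iff pi_push_def)
  then show ?thesis
    using linear_compose[OF linear_push[OF projection_differentiable in_carrier_bundle]
        linear_incl[OF base]] by simp
qed

lemma \<pi>_in: "\<pi> a \<in> tangent x"
  using push_projection_in by (simp add: pi_push_def sub_tangent_space_def)

text \<open>Takes the chart that \<open>push\<close> selects, so that \<open>push_projection\<close>
  describes the projection by the first coordinate component.\<close>

lemma bundle_chart_at:
  obtains c W E where "bundle_chart A B g c W E \<in> bundle_atlas" "normal_frame A B g W E"
    "c \<in> B" "x \<in> W" "x \<in> fst c"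
    "\<forall>a. push bundle_atlas B fst (x, \<theta>) a c = fst (a (bundle_chart A B g c W E))"
proof -
  note C = chart_at[OF in_carrier_bundle]
  obtain c W E where *: "chart_at bundle_atlas (x, \<theta>) = bundle_chart A B g c W E" "c \<in> B"
    "W \<subseteq> fst c" "openin (atlas_topology B) W" "normal_frame A B g W E"
    by (rule normal_atlasE[OF C(1)])
  then show ?thesis
    using that[of c W E] C push_projection[OF in_carrier_bundle *(1-5)] by auto
qed

lemma vertical_in: "n \<in> normal x \<Longrightarrow> vertical n \<in> T"
  by (rule velocity_vertical_in_tangent_space[OF base fibre])

lemma \<pi>_vertical:
  assumes "n \<in> normal x"
  shows "\<pi> (vertical n) = 0"
proof -
  obtain c W E where C: "bundle_chart A B g c W E \<in> bundle_atlas" "normal_frame A B g W E"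
    "c \<in> B" "x \<in> W" "x \<in> fst c"
    "\<forall>a. push bundle_atlas B fst (x, \<theta>) a c = fst (a (bundle_chart A B g c W E))"
    by (rule bundle_chart_at)
  have "push bundle_atlas B fst (x, \<theta>) (vertical n) c = 0 c"
    by (simp add: C(6) velocity_vertical(1)[OF C(1,2,4) fibre assms])
  then have "push bundle_atlas B fst (x, \<theta>) (vertical n) = 0"
    using push_projection_in subspace_0[OF subspace_tangent_space[OF sub_atlas]] C(3,5)
    by (blast intro: tangent_space_eqI)
  then show ?thesis
    by (simp add: pi_push_def linear_0[OF linear_incl[OF base]])
qed

text \<open>The inclusion is injective on tangent vectors, so the first coordinate component of
  \<open>a\<close> vanishes. The frame turns the second component into the normal vector whose line
  has velocity \<open>a\<close>.\<close>

lemma \<pi>_kernel: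
  assumes a: "a \<in> T" "\<pi> a = 0"
  obtains n where "n \<in> normal x" "a = vertical n"
proof -
  obtain c W E where C: "bundle_chart A B g c W E \<in> bundle_atlas" "normal_frame A B g W E"
    "c \<in> B" "x \<in> W" "x \<in> fst c"
    "\<forall>a. push bundle_atlas B fst (x, \<theta>) a c = fst (a (bundle_chart A B g c W E))"
    by (rule bundle_chart_at)
  have "incl A B x (push bundle_atlas B fst (x, \<theta>) a) = incl A B x 0"
    using a(2) by (simp add: pi_push_def linear_0[OF linear_incl[OF base]])
  then have "push bundle_atlas B fst (x, \<theta>) a = 0"
    using inj_onD[OF inj_on_incl[OF base]] push_projection_in
      subspace_0[OF subspace_tangent_space[OF sub_atlas]] by blast
  then have fst0: "fst (a (bundle_chart A B g c W E)) = 0"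
    by (simp flip: C(6)[rule_format])
  define n where "n = E x (snd (a (bundle_chart A B g c W E)))"
  have n: "n \<in> normal x"
    using frame_in[OF C(2,4)] by (simp add: n_def)
  have "vertical n (bundle_chart A B g c W E) = a (bundle_chart A B g c W E)"
    unfolding velocity_vertical(1)[OF C(1,2,4) fibre n]
    by (simp add: n_def frame_inv_left[OF C(2,4)] prod_eq_iff fst0)
  then have "a = vertical n"
    using tangent_space_eqI[OF a(1) vertical_in[OF n] C(1)] C(4) fibre by simp
  then show ?thesis
    using that n by blast
qed

text \<open>The preimage has zero fibre coordinate in one chart; it need not be horizontal, which is
  corrected in \<open>T_splitting\<close>.\<close>

lemma \<pi>_surj:
  assumes "u \<in> tangent x"
  obtains a where "a \<in> T" "\<pi> a = u"
proof -
  obtain c W E where C: "bundle_chart A B g c W E \<in> bundle_atlas" "normal_frame A B g W E"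
    "c \<in> B" "x \<in> W" "x \<in> fst c"
    "\<forall>a. push bundle_atlas B fst (x, \<theta>) a c = fst (a (bundle_chart A B g c W E))"
    by (rule bundle_chart_at)
  obtain v where v: "v \<in> tangent_space B x" "u = incl A B x v"
    using assms by (auto simp: sub_tangent_space_def)
  have "(x, \<theta>) \<in> fst (bundle_chart A B g c W E)"
    using C(4) fibre by simp
  then obtain a where a: "a \<in> T" "a (bundle_chart A B g c W E) = (v c, 0)"
    by (rule tangent_space_coordinate_surj[OF differentiable_atlas_at_bundle C(1)])
  have "push bundle_atlas B fst (x, \<theta>) a = v"
    using a(2) by (intro tangent_space_eqI[OF push_projection_in v(1) C(3,5)]) (simp add: C(6))
  then show ?thesis
    using that[OF a(1)] v(2) by (simp add: pi_push_def)
qed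

text \<open>The difference lies in the kernel of \<pi>, hence is \<open>vertical n\<close> for some
  \<open>n\<close>, and \<kappa> recovers \<open>n = 0\<close>.\<close>

lemma T_eqI:
  assumes a: "a \<in> T" and b: "b \<in> T" and "\<pi> a = \<pi> b" and "\<kappa> a = \<kappa> b"
  shows "a = b"
proof -
  have ab: "a - b \<in> T"
    using subspace_diff[OF subspace_T a b] .
  have "\<pi> (a - b) = 0"
    using assms(3) by (simp add: linear_diff[OF linear_\<pi>])
  then obtain n where n: "n \<in> normal x" "a - b = vertical n"
    by (rule \<pi>_kernel[OF ab])
  have "\<kappa> a = \<kappa> (a - b) + \<kappa> b"
    using \<kappa>_add[OF ab b] by simp
  then have "n = 0"
    using \<kappa>_vertical[OF n(1)] n(2) assms(4) by simp
  \<comment> \<open>The zero vector is itself \<open>vertical m\<close> for some \<open>m\<close>,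
    and \<kappa> forces \<open>m = 0\<close>; so \<open>vertical 0 = 0\<close> needs no separate
    computation.\<close>
  moreover obtain m where m: "m \<in> normal x" "0 = vertical m"
    by (rule \<pi>_kernel[OF subspace_0[OF subspace_T] linear_0[OF linear_\<pi>]])
  moreover have "\<kappa> 0 = 0"
    using \<kappa>_scaleR[OF subspace_0[OF subspace_T], of 0] by simp
  ultimately have "a - b = 0"
    using n(2) \<kappa>_vertical[OF m(1)] by simp
  then show ?thesis
    by simp
qed

text \<open>Any preimage \<open>b\<close> of \<open>u\<close> is corrected by the vertical vector of
  \<open>n - \<kappa> b\<close>. This makes the descriptions that define both lifts well
  posed.\<close>

lemma T_splitting:
  assumes u: "u \<in> tangent x" and n: "n \<in> normal x"
  shows "\<exists>!a. a \<in> T \<and> \<pi> a = u \<and> \<kappa> a = n"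
proof -
  obtain b where b: "b \<in> T" "\<pi> b = u"
    by (rule \<pi>_surj[OF u])
  have m: "n - \<kappa> b \<in> normal x"
    using subspace_diff[OF subspace_normal[OF base] n \<kappa>_in[OF b(1)]] .
  let ?a = "b + vertical (n - \<kappa> b)"
  have a: "?a \<in> T"
    by (rule subspace_add[OF subspace_T b(1) vertical_in[OF m]])
  have "\<pi> ?a = u" "\<kappa> ?a = n"
    unfolding linear_add[OF linear_\<pi>] \<pi>_vertical[OF m] \<kappa>_add[OF b(1) vertical_in[OF m]]
      \<kappa>_vertical[OF m] b(2) by simp_all
  then show ?thesis
    using a by (intro ex1I[of _ ?a]) (auto intro: T_eqI)
qed

section \<open>Horizontal and vertical lifts\<close>

lemma horizontal_lift:
  assumes "u \<in> tangent x"
  shows "horizontal_lift A B g K (x, \<theta>) u \<in> T"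
    and "\<pi> (horizontal_lift A B g K (x, \<theta>) u) = u"
    and "\<kappa> (horizontal_lift A B g K (x, \<theta>) u) = 0"
proof -
  have "\<exists>!a. a \<in> T \<and> \<kappa> a = 0 \<and> \<pi> a = u"
    using T_splitting[OF assms subspace_0[OF subspace_normal[OF base]]] by (simp only: conj_commute)
  from theI'[OF this] show "horizontal_lift A B g K (x, \<theta>) u \<in> T"
    "\<pi> (horizontal_lift A B g K (x, \<theta>) u) = u" "\<kappa> (horizontal_lift A B g K (x, \<theta>) u) = 0"
    by (simp_all add: horizontal_lift_def)
qed

lemma vertical_lift:
  assumes "n \<in> normal x"
  shows "vertical_lift A B g K (x, \<theta>) n \<in> T"
    and "\<pi> (vertical_lift A B g K (x, \<theta>) n) = 0"
    and "\<kappa> (vertical_lift A B g K (x, \<theta>) n) = n"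
  using theI'[OF T_splitting[OF subspace_0[OF subspace_tangent[OF base]] assms]]
  by (simp_all add: vertical_lift_def)


section \<open>The almost Hermitian structure\<close>

definition "\<sigma> = g x \<theta> \<theta>"
definition "\<rho> = sqrt (1 + q * \<sigma>)"
definition "\<omega> = (1 / (1 + \<sigma>)) powr (p / 2)"
definition "c = q / (1 + \<rho>)"
definition "c' = q / (1 + q * \<sigma> + \<rho>)"
abbreviation "j \<equiv> J x"

lemmas baseA = carrier_subset[OF base]
lemmas ambient = normal_ambient tangent_ambient[OF base]
lemmas ambient_subspace = subspace_tangent_space[OF ambient_atlas, of x]
lemmas ambient_closed = subspace_add[OF ambient_subspace] subspace_scale[OF ambient_subspace]
  subspace_diff[OF ambient_subspace] subspace_neg[OF ambient_subspace] J_in[OF baseA]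

lemma metric_scaleR_right: "u \<in> tangent_space A x \<Longrightarrow> n \<in> tangent_space A x \<Longrightarrow>
    g x n (t *\<^sub>R u) = t * g x n u"
  and metric_scaleR_left: "u \<in> tangent_space A x \<Longrightarrow> n \<in> tangent_space A x \<Longrightarrow>
    g x (t *\<^sub>R u) n = t * g x u n"
  using metric_scaleR[OF baseA] metric_commute[OF baseA] ambient_closed by metis+

lemma metric_minus_right: "u \<in> tangent_space A x \<Longrightarrow> n \<in> tangent_space A x \<Longrightarrow>
    g x n (- u) = - g x n u"
  and metric_minus_left: "u \<in> tangent_space A x \<Longrightarrow> n \<in> tangent_space A x \<Longrightarrow>
    g x (- u) n = - g x u n"
  using metric_scaleR_right[of u n "-1"] metric_scaleR_left[of u n "-1"] by simp_all

lemma metric_add_diff: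
  assumes "u \<in> tangent_space A x" "v \<in> tangent_space A x" "n \<in> tangent_space A x"
  shows "g x n (u + v) = g x n u + g x n v" "g x (u + v) n = g x u n + g x v n"
    "g x n (u - v) = g x n u - g x n v" "g x (u - v) n = g x u n - g x v n"
proof -
  have add: "g x n (u + v) = g x n u + g x n v" "g x (u + v) n = g x u n + g x v n"
    if "v \<in> tangent_space A x" for v
    using assms that metric_add[OF baseA] metric_commute[OF baseA] ambient_closed by metis+
  show "g x n (u + v) = g x n u + g x n v" "g x (u + v) n = g x u n + g x v n"
    using add assms(2) by blast+
  show "g x n (u - v) = g x n u - g x n v" "g x (u - v) n = g x u n - g x v n"
    using add[of "- v"] assms ambient_closed(4) by (simp_all add: metric_minus_right metric_minus_left)
qed

lemmas metric_bilinear = metric_add_diff metric_scaleR_right metric_scaleR_left metric_minus_right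
  metric_minus_left

lemmas j_scaleR = J_scaleR[OF baseA]

lemma j_diff:
  assumes "u \<in> tangent_space A x" "v \<in> tangent_space A x"
  shows "j (u - v) = j u - j v"
  using J_add[OF baseA assms(1), of "(-1) *\<^sub>R v"] j_scaleR[OF assms(2), of "-1"]
    ambient_closed(4)[OF assms(2)] by simp

lemmas j_linear = J_add[OF baseA] j_diff j_scaleR

lemma metric_nonneg:
  assumes "v \<in> tangent_space A x"
  shows "0 \<le> g x v v"
  using metric_pos[OF baseA assms] metric_scaleR_right[OF assms assms, of 0] by (cases "v = 0") auto

lemma \<sigma>_nonneg: "0 \<le> \<sigma>"
  unfolding \<sigma>_def by (rule metric_nonneg[OF ambient(1)[OF fibre]])

text \<open>With \<open>q \<ge> 0\<close> the radicand is positive. The last identity brings the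
  denominator of \<open>c'\<close> into the form used in \<open>sqrt_coefficients\<close>.\<close>

lemma \<rho>: "0 < \<rho>" "q * \<sigma> = \<rho>\<^sup>2 - 1" "\<rho>\<^sup>2 + \<rho> = 1 + q * \<sigma> + \<rho>"
proof -
  have "0 \<le> q * \<sigma>"
    using q \<sigma>_nonneg by simp
  then show "0 < \<rho>" "q * \<sigma> = \<rho>\<^sup>2 - 1" "\<rho>\<^sup>2 + \<rho> = 1 + q * \<sigma> + \<rho>"
    by (simp_all add: \<rho>_def)
qed

lemma \<omega>: "0 < \<omega>" "\<omega>\<^sup>2 = (1 / (1 + \<sigma>)) powr p"
proof -
  have "0 < 1 / (1 + \<sigma>)"
    using \<sigma>_nonneg by simp
  then show "0 < \<omega>" "\<omega>\<^sup>2 = (1 / (1 + \<sigma>)) powr p"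
    by (simp_all add: \<omega>_def power2_eq_square flip: powr_add)
qed

lemmas coefficients = sqrt_coefficients[OF \<rho>(1,2), unfolded \<rho>(3), folded c_def c'_def]

section \<open>The two off-diagonal blocks of the almost complex structure\<close>

definition to_horizontal :: "('m, 'e) tvec \<Rightarrow> ('m, 'e) tvec"
  where "to_horizontal n = \<omega> *\<^sub>R (j n + (c * g x n \<theta>) *\<^sub>R j \<theta>)"

definition to_vertical :: "('m, 'e) tvec \<Rightarrow> ('m, 'e) tvec"
  where "to_vertical u = (1 / \<omega>) *\<^sub>R (j u - (c' * g x (j u) \<theta>) *\<^sub>R \<theta>)"

lemma to_horizontal_add: "m \<in> normal x \<Longrightarrow> n \<in> normal x \<Longrightarrow>
    to_horizontal (m + n) = to_horizontal m + to_horizontal n"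
  and to_horizontal_scaleR: "n \<in> normal x \<Longrightarrow> to_horizontal (t *\<^sub>R n) = t *\<^sub>R to_horizontal n"
  using ambient(1) ambient_closed ambient(1)[OF fibre]
  by (simp_all add: to_horizontal_def j_linear metric_bilinear algebra_simps)

lemma to_vertical_add: "u \<in> tangent x \<Longrightarrow> v \<in> tangent x \<Longrightarrow>
    to_vertical (u + v) = to_vertical u + to_vertical v"
  and to_vertical_scaleR: "u \<in> tangent x \<Longrightarrow> to_vertical (t *\<^sub>R u) = t *\<^sub>R to_vertical u"
  using ambient(2) ambient_closed ambient(1)[OF fibre]
  by (simp_all add: to_vertical_def j_linear metric_bilinear algebra_simps)

text \<open>Since \<open>j (j u) = - u\<close>, only the multiples of \<open>j \<theta>\<close> have
  to cancel, and their total coefficient is a multiple of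
  \<open>c - c' - c * c' * \<sigma>\<close>.\<close>

lemma to_horizontal_to_vertical:
  assumes "u \<in> tangent x"
  shows "to_horizontal (to_vertical u) = - u"
proof -
  note [simp] = \<sigma>_def[symmetric] ambient_closed ambient(1)[OF fibre]
    ambient(2)[OF assms] j_linear metric_bilinear
  let ?\<gamma> = "g x (j u) \<theta>"
  have w0: "\<omega> \<noteq> 0"
    using \<omega>(1) by simp
  have j: "j (to_vertical u) = (1 / \<omega>) *\<^sub>R (- u - (c' * ?\<gamma>) *\<^sub>R j \<theta>)"
    by (simp add: to_vertical_def J_J[OF baseA])
  have g: "g x (to_vertical u) \<theta> = (1 / \<omega>) * (?\<gamma> - c' * ?\<gamma> * \<sigma>)"
    by (simp add: to_vertical_def)
  have "to_horizontal (to_vertical u) =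
      (\<omega> * (1 / \<omega>)) *\<^sub>R (- u + ((c - c' - c * c' * \<sigma>) * ?\<gamma>) *\<^sub>R j \<theta>)"
    unfolding to_horizontal_def j g by (simp add: algebra_simps del: times_divide_eq_right)
  then show ?thesis
    using w0 by (simp add: coefficients(1))
qed

text \<open>The same scalar combination appears, this time in front of \<theta>.\<close>

lemma to_vertical_to_horizontal:
  assumes "n \<in> normal x"
  shows "to_vertical (to_horizontal n) = - n"
proof -
  note [simp] = \<sigma>_def[symmetric] ambient_closed ambient(1)[OF fibre]
    ambient(1)[OF assms] j_linear metric_bilinear
  let ?\<gamma> = "g x n \<theta>"
  have w0: "\<omega> \<noteq> 0"
    using \<omega>(1) by simp
  have j: "j (to_horizontal n) = \<omega> *\<^sub>R (- n - (c * ?\<gamma>) *\<^sub>R \<theta>)"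
    by (simp add: to_horizontal_def J_J[OF baseA])
  have g: "g x (j (to_horizontal n)) \<theta> = \<omega> * (- ?\<gamma> - c * ?\<gamma> * \<sigma>)"
    unfolding j by simp
  have "to_vertical (to_horizontal n) =
      ((1 / \<omega>) * \<omega>) *\<^sub>R (- n - ((c - c' - c * c' * \<sigma>) * ?\<gamma>) *\<^sub>R \<theta>)"
    unfolding to_vertical_def g unfolding j by (simp add: algebra_simps del: times_divide_eq_left)
  then show ?thesis
    using w0 by (simp add: coefficients(1))
qed

lemma J_metric: "u \<in> tangent_space A x \<Longrightarrow> v \<in> tangent_space A x \<Longrightarrow> g x (j u) (j v) = g x u v"
  using J_isometry baseA by blast

text \<open>As \<open>j\<close> is an isometry, the two cross terms contribute \<open>2 * c\<close>
  and the square of the correction \<open>c\<^sup>2 * \<sigma>\<close>, which add up to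
  \<open>q\<close>.\<close>

lemma to_horizontal_metric:
  assumes "m \<in> normal x" "n \<in> normal x"
  shows "g x (to_horizontal m) (to_horizontal n) = \<omega>\<^sup>2 * (g x m n + q * g x m \<theta> * g x n \<theta>)"
proof -
  note [simp] = \<sigma>_def[symmetric] ambient_closed ambient(1)[OF fibre]
    ambient(1)[OF assms(1)] ambient(1)[OF assms(2)]
    metric_bilinear J_metric
  have "g x (to_horizontal m) (to_horizontal n) =
      \<omega>\<^sup>2 * (g x m n + (2 * c + c\<^sup>2 * \<sigma>) * g x m \<theta> * g x n \<theta>)"
    unfolding to_horizontal_def
    by (simp add: metric_commute[OF baseA, of \<theta> n] algebra_simps power2_eq_square)
  then show ?thesis
    by (simp only: coefficients(2))
qed

text \<open>Pairing with \<theta> multiplies \<open>g x (j u) \<theta>\<close> by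
  \<open>1 - c' * \<sigma>\<close> up to the factor \<open>1 / \<omega>\<close>, so all terms beyond
  \<open>g x u v\<close> carry the third coefficient expression, which is zero.\<close>

lemma to_vertical_metric:
  assumes "u \<in> tangent x" "v \<in> tangent x"
  shows "\<omega>\<^sup>2 * (g x (to_vertical u) (to_vertical v) +
    q * g x (to_vertical u) \<theta> * g x (to_vertical v) \<theta>) = g x u v"
proof -
  note [simp] = \<sigma>_def[symmetric] ambient_closed ambient(1)[OF fibre]
    ambient(2)[OF assms(1)] ambient(2)[OF assms(2)]
    metric_bilinear J_metric
  let ?\<alpha> = "g x (j u) \<theta>" and ?\<beta> = "g x (j v) \<theta>"
  have w0: "\<omega> \<noteq> 0"
    using \<omega>(1) by simp
  have "g x (to_vertical u) (to_vertical v) =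
      (1 / \<omega>) * (1 / \<omega>) * (g x u v + (c'\<^sup>2 * \<sigma> - 2 * c') * ?\<alpha> * ?\<beta>)"
    unfolding to_vertical_def
    by (simp add: metric_commute[OF baseA, of \<theta> "j v"] algebra_simps power2_eq_square
        del: times_divide_eq_right times_divide_eq_left)
  moreover have "g x (to_vertical u) \<theta> = (1 / \<omega>) * ((1 - c' * \<sigma>) * ?\<alpha>)"
    "g x (to_vertical v) \<theta> = (1 / \<omega>) * ((1 - c' * \<sigma>) * ?\<beta>)"
    unfolding to_vertical_def
    by (simp_all add: algebra_simps del: times_divide_eq_right times_divide_eq_left)
  ultimately have "\<omega>\<^sup>2 * (g x (to_vertical u) (to_vertical v) +
      q * g x (to_vertical u) \<theta> * g x (to_vertical v) \<theta>) =
      (\<omega> * (1 / \<omega>))\<^sup>2 * (g x u v + (q * (1 - c' * \<sigma>)\<^sup>2 + c'\<^sup>2 * \<sigma> - 2 * c') * ?\<alpha> * ?\<beta>)"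
    by (simp only:) (simp add: algebra_simps power2_eq_square
        del: times_divide_eq_right times_divide_eq_left)
  then show ?thesis
    using w0 by (simp add: coefficients(3))
qed

section \<open>Block form of the structure and of the metric\<close>

abbreviation "Jt_point \<equiv> Jt A B g J K p q (x, \<theta>)"
abbreviation "Jtv \<equiv> Jt_vertical A B g J K p q (x, \<theta>)"
abbreviation "Jth \<equiv> Jt_horizontal A B g J K p q (x, \<theta>)"
abbreviation "h \<equiv> pq_metric A B g K p q (x, \<theta>)"

lemma Jt_vertical:
  assumes "n \<in> normal x"
  shows "Jtv n \<in> T" and "\<pi> (Jtv n) = to_horizontal n" and "\<kappa> (Jtv n) = 0"
proof -
  note lift = horizontal_lift[OF J_normal[OF base assms]] horizontal_lift[OF J_normal[OF base fibre]]
  note closed = subspace_add[OF subspace_T] subspace_scale[OF subspace_T]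
  show "Jtv n \<in> T" "\<pi> (Jtv n) = to_horizontal n" "\<kappa> (Jtv n) = 0"
    using lift closed
    by (simp_all add: Jt_vertical_def to_horizontal_def sq_norm_def omega_def Let_def
        \<omega>_def \<rho>_def c_def c'_def \<sigma>_def
        linear_add[OF linear_\<pi>] linear_cmul[OF linear_\<pi>] \<kappa>_add \<kappa>_scaleR)
qed

lemma Jt_horizontal:
  assumes "u \<in> tangent x"
  shows "Jth u \<in> T" and "\<pi> (Jth u) = 0" and "\<kappa> (Jth u) = to_vertical u"
proof -
  note lift = vertical_lift[OF J_tangent[OF base assms]] vertical_lift[OF fibre]
  note closed = subspace_diff[OF subspace_T] subspace_scale[OF subspace_T]
  have diff: "\<kappa> (a - b) = \<kappa> a - \<kappa> b" if "a \<in> T" "b \<in> T" for a b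
    using \<kappa>_add[OF closed(1)[OF that] that(2)] by (simp add: algebra_simps)
  show "Jth u \<in> T" "\<pi> (Jth u) = 0" "\<kappa> (Jth u) = to_vertical u"
    using lift closed
    by (simp_all add: Jt_horizontal_def to_vertical_def sq_norm_def omega_def Let_def
        \<omega>_def \<rho>_def c_def c'_def \<sigma>_def
        linear_diff[OF linear_\<pi>] linear_cmul[OF linear_\<pi>] diff \<kappa>_scaleR)
qed

text \<open>The structure exchanges the two components of a tangent vector. The remaining claims are
  checked on these components, with equalities of vectors obtained from
  \<open>T_eqI\<close>.\<close>

lemma Jt:
  assumes "a \<in> T"
  shows Jt_in: "Jt_point a \<in> T" and \<pi>_Jt: "\<pi> (Jt_point a) = to_horizontal (\<kappa> a)"
    and \<kappa>_Jt: "\<kappa> (Jt_point a) = to_vertical (\<pi> a)"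
  using Jt_vertical[OF \<kappa>_in[OF assms]] Jt_horizontal[OF \<pi>_in[of a]] subspace_add[OF subspace_T]
  by (simp_all add: Jt_def linear_add[OF linear_\<pi>] \<kappa>_add)

text \<open>\<omega> carries the exponent \<open>p / 2\<close>, so the conformal factor of the
  metric is its square.\<close>

lemma pq_metric_eq:
  "h a b = g x (\<pi> a) (\<pi> b) + \<omega>\<^sup>2 * (g x (\<kappa> a) (\<kappa> b) + q * g x (\<kappa> a) \<theta> * g x (\<kappa> b) \<theta>)"
  by (simp add: pq_metric_def Let_def omega_def sq_norm_def \<omega>(2) \<sigma>_def)

lemma inner_product_on_pq_metric: "inner_product_on T h"
  unfolding inner_product_on_def
proof (intro conjI ballI impI)
  fix a b assume a: "a \<in> T" and b: "b \<in> T"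
  show "h a b = h b a"
    using metric_commute[OF baseA] ambient \<pi>_in \<kappa>_in[OF a] \<kappa>_in[OF b] by (simp add: pq_metric_eq)
next
  fix a assume a: "a \<in> T"
  show "linear_on_space T (h a)"
    unfolding linear_on_space_def
    using ambient(1)[OF \<kappa>_in] ambient(2)[OF \<pi>_in] ambient(1)[OF fibre] a
    by (simp add: pq_metric_eq linear_add[OF linear_\<pi>] linear_cmul[OF linear_\<pi>] \<kappa>_add \<kappa>_scaleR
        metric_bilinear algebra_simps)
  assume "a \<noteq> 0"
  \<comment> \<open>A nonzero vector has a nonzero component by \<open>T_eqI\<close>; the
    corresponding summand is positive and the others are nonnegative because
    \<open>q \<ge> 0\<close>.\<close>
  then have "\<pi> a \<noteq> 0 \<or> \<kappa> a \<noteq> 0"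
    using T_eqI[OF a subspace_0[OF subspace_T]] linear_0[OF linear_\<pi>]
      \<kappa>_scaleR[OF subspace_0[OF subspace_T], of 0] by auto
  moreover have "0 \<le> q * g x (\<kappa> a) \<theta> * g x (\<kappa> a) \<theta>"
    using q by (simp add: mult.assoc)
  moreover have "0 < \<omega>\<^sup>2"
    using \<omega>(1) by simp
  ultimately show "0 < h a a"
    unfolding pq_metric_eq
    using metric_nonneg[OF ambient(2)[OF \<pi>_in]] metric_nonneg[OF ambient(1)[OF \<kappa>_in[OF a]]]
      metric_pos[OF baseA ambient(2)[OF \<pi>_in]] metric_pos[OF baseA ambient(1)[OF \<kappa>_in[OF a]]]
    by (metis add_nonneg_pos add_pos_nonneg mult_nonneg_nonneg mult_pos_pos order_less_imp_le
        add_nonneg_nonneg)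
qed

lemma linear_endomorphism_Jt: "linear_endomorphism T Jt_point"
  unfolding linear_endomorphism_def linear_on_space_def
proof (intro conjI ballI allI)
  note closed = subspace_add[OF subspace_T] subspace_scale[OF subspace_T]
  show "Jt_point ` T \<subseteq> T"
    using Jt_in by blast
  show "Jt_point (a + b) = Jt_point a + Jt_point b" if "a \<in> T" "b \<in> T" for a b
    using that closed \<kappa>_in \<pi>_in
    by (intro T_eqI) (simp_all add: Jt linear_add[OF linear_\<pi>] \<kappa>_add to_horizontal_add
        to_vertical_add)
  show "Jt_point (t *\<^sub>R a) = t *\<^sub>R Jt_point a" if "a \<in> T" for t a
    using that closed \<kappa>_in \<pi>_in
    by (intro T_eqI) (simp_all add: Jt linear_cmul[OF linear_\<pi>] \<kappa>_scaleR to_horizontal_scaleR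
        to_vertical_scaleR)
qed

text \<open>On a vertical lift the horizontal contribution is \<open>Jth 0\<close>, whose components
  vanish because \<open>to_vertical 0 = 0\<close>.\<close>

lemma Jt_vertical_lift:
  assumes "n \<in> normal x"
  shows "Jt_point (vertical_lift A B g K (x, \<theta>) n) = Jtv n"
proof (rule T_eqI)
  have "to_vertical 0 = 0"
    using to_vertical_scaleR[of 0 0] subspace_0[OF subspace_tangent[OF base]] by simp
  then show "\<kappa> (Jt_point (vertical_lift A B g K (x, \<theta>) n)) = \<kappa> (Jtv n)"
    by (simp add: Jt vertical_lift[OF assms] Jt_vertical[OF assms])
qed (simp_all add: Jt vertical_lift[OF assms] Jt_vertical[OF assms])

lemma Jt_horizontal_lift:
  assumes "u \<in> tangent x"
  shows "Jt_point (horizontal_lift A B g K (x, \<theta>) u) = Jth u"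
proof (rule T_eqI)
  have "to_horizontal 0 = 0"
    using to_horizontal_scaleR[of 0 0] subspace_0[OF subspace_normal[OF base]] by simp
  then show "\<pi> (Jt_point (horizontal_lift A B g K (x, \<theta>) u)) = \<pi> (Jth u)"
    by (simp add: Jt horizontal_lift[OF assms] Jt_horizontal[OF assms])
qed (simp_all add: Jt horizontal_lift[OF assms] Jt_horizontal[OF assms])

lemma Jt_Jt:
  assumes "a \<in> T"
  shows "Jt_point (Jt_point a) = - a"
proof (rule T_eqI)
  have "\<kappa> (- a) = - \<kappa> a"
    using \<kappa>_scaleR[OF assms, of "-1"] by simp
  then show "\<kappa> (Jt_point (Jt_point a)) = \<kappa> (- a)"
    using assms by (simp add: Jt to_vertical_to_horizontal \<kappa>_in)
  show "\<pi> (Jt_point (Jt_point a)) = \<pi> (- a)"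
    using assms by (simp add: Jt to_horizontal_to_vertical \<pi>_in linear_neg[OF linear_\<pi>])
qed (use assms subspace_neg[OF subspace_T] in \<open>simp_all add: Jt_in\<close>)

text \<open>The exchange of components turns the vertical part of the metric into the horizontal
  part of the image, and conversely, so the two block identities are simply added.\<close>

lemma Jt_isometry:
  assumes "a \<in> T" "b \<in> T"
  shows "h (Jt_point a) (Jt_point b) = h a b"
  unfolding pq_metric_eq \<pi>_Jt[OF assms(1)] \<pi>_Jt[OF assms(2)] \<kappa>_Jt[OF assms(1)] \<kappa>_Jt[OF assms(2)]
  by (simp add: to_horizontal_metric to_vertical_metric \<kappa>_in assms \<pi>_in)

end

text \<open>The two clauses on lifts confirm that \<open>Jt\<close>, defined by decomposing a
  tangent vector, is the linear extension of the prescribed values.\<close>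

theorem proposition1:
  fixes A :: "('m, 'e::euclidean_space) chart set"
    and B :: "('m, 'f::euclidean_space) chart set"
    and g :: "'m \<Rightarrow> ('m, 'e) tvec \<Rightarrow> ('m, 'e) tvec \<Rightarrow> real"
    and J :: "'m \<Rightarrow> ('m, 'e) tvec \<Rightarrow> ('m, 'e) tvec"
    and nabla :: "('m, 'e) connection"
    and K :: "'m \<times> ('m, 'e) tvec \<Rightarrow> ('m, 'e, 'f) ntvec \<Rightarrow> ('m, 'e) tvec"
    and p q :: real
  assumes "smooth_manifold A" and "DIM('e) = 2 * DIM('f)"
    and "riemannian_metric A g" and "almost_complex_structure A J"
    and "\<forall>x\<in>carrier_of A. \<forall>u\<in>tangent_space A x. \<forall>v\<in>tangent_space A x.
           g x (J x u) (J x v) = g x u v"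
    and "submanifold A B" and "totally_real A B g J"
    and "levi_civita A g nabla" and "connection_map A B g nabla K"
    and "q \<ge> 0"
  shows "\<forall>z\<in>normal_bundle A B g. let T = tangent_space (normal_atlas A B g) z in
    inner_product_on T (pq_metric A B g K p q z) \<and>
    linear_endomorphism T (Jt A B g J K p q z) \<and>
    (\<forall>\<xi>\<in>normal_fibre A B g (fst z).
       Jt A B g J K p q z (vertical_lift A B g K z \<xi>) = Jt_vertical A B g J K p q z \<xi>) \<and>
    (\<forall>X\<in>sub_tangent_space A B (fst z).
       Jt A B g J K p q z (horizontal_lift A B g K z X) = Jt_horizontal A B g J K p q z X) \<and>
    (\<forall>a\<in>T. Jt A B g J K p q z (Jt A B g J K p q z a) = - a) \<and>
    (\<forall>a\<in>T. \<forall>b\<in>T.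
       pq_metric A B g K p q z (Jt A B g J K p q z a) (Jt A B g J K p q z b) =
       pq_metric A B g K p q z a b)"
proof
  fix z assume "z \<in> normal_bundle A B g"
  then obtain x \<theta> where z: "z = (x, \<theta>)" and x: "x \<in> carrier_of B" and \<theta>: "\<theta> \<in> normal_fibre A B g x"
    by (auto simp: normal_bundle_def)
  interpret normal_bundle_point A B g J nabla K p q x \<theta>
    by unfold_locales (rule assms x \<theta>)+
  show "let T = tangent_space (normal_atlas A B g) z in
    inner_product_on T (pq_metric A B g K p q z) \<and>
    linear_endomorphism T (Jt A B g J K p q z) \<and>
    (\<forall>\<xi>\<in>normal_fibre A B g (fst z).
       Jt A B g J K p q z (vertical_lift A B g K z \<xi>) = Jt_vertical A B g J K p q z \<xi>) \<and>
    (\<forall>X\<in>sub_tangent_space A B (fst z).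
       Jt A B g J K p q z (horizontal_lift A B g K z X) = Jt_horizontal A B g J K p q z X) \<and>
    (\<forall>a\<in>T. Jt A B g J K p q z (Jt A B g J K p q z a) = - a) \<and>
    (\<forall>a\<in>T. \<forall>b\<in>T.
       pq_metric A B g K p q z (Jt A B g J K p q z a) (Jt A B g J K p q z b) =
       pq_metric A B g K p q z a b)"
    unfolding z Let_def fst_conv
    using inner_product_on_pq_metric linear_endomorphism_Jt Jt_vertical_lift Jt_horizontal_lift
      Jt_Jt Jt_isometry by blast
qed
end
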